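(* Let $n\ge 2$, let $G\subset\mathbb{R}^n$ be a non-empty open set with non-empty boundary, and assume that $1\le p\le q<np/(n-p)<\infty$ and $\beta\in\mathbb{R}$ are such that $G$ admits a $(q,p,\beta)$-Hardy--Sobolev inequality. (1) If $\beta\ge0$ and $q(n-p+\beta)/p\neq n$, then either $$\overline{\dim}_A(G^c)<\frac{q}{p}(n-p+\beta)\quad\text{or}\quad \dim_H(G^c)\ge n-p+\beta.$$ (2) If $\beta<0$ and $G^c$ is compact and porous, then either $$\overline{\dim}_A(G^c)<\frac{q}{p}(n-p+\beta)\quad\text{or}\quad \underline{\dim}_M(G^c)\ge n-p+\beta.$$
   Context: $G^c=\mathbb{R}^n\setminus G$, $\delta_{\partial G}(x)=\operatorname{dist}(x,\partial G)$, $B(x,R)$ is the open ball, $d(E)$ is the diameter of $E$, $\dim_H$ is Hausdorff dimension, and $C_0^\infty(G)$ denotes smooth functions with compact support in $G$. An open set $G$ admits a $(q,p,\beta)$-Hardy--Sobolev inequality if there is a constant $C>0$ such that $$\biggl(\int_{G} |f|^q \,\delta_{\partial G}^{(q/p)(n-p+\beta)-n}\,dx\biggr)^{1/q}\le C \biggl(\int_G |\nabla f|^p\,\delta_{\partial G}^{\beta}\,dx\biggr)^{1/p}$$ for all $f\in C_0^\infty(G)$. For bounded $A\subset\mathbb{R}^n$ and $r>0$, $N(A,r)$ is the minimal number of open balls of radius $r$ centered at points of $A$ needed to cover $A$. The (upper) Assouad dimension is $\overline{\dim}_A(E)=\inf\{\lambda\ge 0:\ \exists\, C_\lambda>0 \text{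 such that } N(E\cap B(x,R),r)\le C_\lambda (r/R)^{-\lambda}\text{ for all } x\in E,\ 0<r<R<d(E)\}$. For bounded $E$, the lower Minkowski dimension is $\underline{\dim}_M(E)=\inf\{\lambda\ge0:\ \liminf_{r\to0}N(E,r)r^\lambda=0\}$. A set $E\subset\mathbb{R}^n$ is porous if there is a constant $0<c<1$ such that for every $x\in E$ and all $0<r<d(E)$ there is a point $y\in\mathbb{R}^n$ with $B(y,cr)\subset B(x,r)\setminus E$. *)

theory Defs
  imports "HOL-Analysis.Analysis"
begin

definition partial_deriv :: "'n::finite \<Rightarrow> (real ^ 'n \<Rightarrow> real) \<Rightarrow> real ^ 'n \<Rightarrow> real" where
  "partial_deriv i f x = frechet_derivative f (at x) (axis i 1)"

definition gradient :: "(real ^ 'n::finite \<Rightarrow> real) \<Rightarrow> real ^ 'n \<Rightarrow> real ^ 'n" where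
  "gradient f x = (\<chi> i. partial_deriv i f x)"

text \<open>\<open>C_diff k f\<close>: the function \<open>f\<close> is of class $C^k$ on the whole space.\<close>

primrec C_diff :: "nat \<Rightarrow> (real ^ 'n::finite \<Rightarrow> real) \<Rightarrow> bool" where
  "C_diff 0 f \<longleftrightarrow> continuous_on UNIV f"
| "C_diff (Suc k) f \<longleftrightarrow> (\<forall>x. f differentiable (at x)) \<and> (\<forall>i. C_diff k (partial_deriv i f))"

definition smooth :: "(real ^ 'n::finite \<Rightarrow> real) \<Rightarrow> bool" where
  "smooth f \<longleftrightarrow> (\<forall>k. C_diff k f)"

text \<open>Elements of $C_0^\infty(G)$ are extended by zero to the whole space; for open \<open>G\<close> the
  extension of a smooth function with compact support in \<open>G\<close> is smooth.\<close>

definition test_functions :: "(real ^ 'n::finite) set \<Rightarrow> (real ^ 'n \<Rightarrow> real) set" where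
  "test_functions G =
    {f. smooth f \<and> compact (closure {x. f x \<noteq> 0}) \<and> closure {x. f x \<noteq> 0} \<subseteq> G}"

text \<open>The notion is only meaningful for open \<open>G\<close> with nonempty boundary. Then the distance to the
  boundary is positive and continuous on \<open>G\<close>, so for $p, q \ge 1$ both integrands are continuous
  with compact support in \<open>G\<close> and the Bochner integrals below are genuine.\<close>

definition hardy_sobolev :: "real \<Rightarrow> real \<Rightarrow> real \<Rightarrow> (real ^ 'n::finite) set \<Rightarrow> bool" where
  "hardy_sobolev q p \<beta> G \<longleftrightarrow>
    (\<exists>C>0. \<forall>f\<in>test_functions G.
      (LINT x:G|lborel. \<bar>f x\<bar> powr q *
          infdist x (frontier G) powr ((q / p) * (real CARD('n) - p + \<beta>) - real CARD('n)))
        powr (1 / q)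
      \<le> C * (LINT x:G|lborel. norm (gradient f x) powr p * infdist x (frontier G) powr \<beta>)
        powr (1 / p))"

text \<open>The library's \<^const>\<open>diameter\<close> is unspecified on unbounded sets, where the
  diameter should be infinite.\<close>

definition ediameter :: "'a::metric_space set \<Rightarrow> ereal" where
  "ediameter E = (if bounded E then ereal (diameter E) else \<infinity>)"

text \<open>Only used for bounded subsets of Euclidean space, where finite covers exist.\<close>

definition covering_number :: "'a::metric_space set \<Rightarrow> real \<Rightarrow> nat" where
  "covering_number A r =
    (LEAST m. \<exists>S. S \<subseteq> A \<and> finite S \<and> card S = m \<and> A \<subseteq> (\<Union>x\<in>S. ball x r))"

definition assouad_dim :: "'a::metric_space set \<Rightarrow> ereal" where
  "assouad_dim E = Inf {ereal s | s. 0 \<le> s \<and>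
    (\<exists>C>0. \<forall>x\<in>E. \<forall>r R. 0 < r \<and> r < R \<and> ereal R < ediameter E \<longrightarrow>
      real (covering_number (E \<inter> ball x R) r) \<le> C * (r / R) powr (- s))}"

definition lower_minkowski_dim :: "'a::metric_space set \<Rightarrow> ereal" where
  "lower_minkowski_dim E = Inf {ereal s | s. 0 \<le> s \<and>
    Liminf (at_right 0) (\<lambda>r. ereal (real (covering_number E r) * r powr s)) = 0}"

text \<open>The gauge $\mathrm{diam}(U)^s$ with the usual conventions $\mathrm{diam}(\emptyset)^s = 0$
  and $0^0 = 1$ for nonempty \<open>U\<close> (whereas \<open>0 powr 0 = 0\<close>).\<close>

definition hausdorff_gauge :: "real \<Rightarrow> 'a::metric_space set \<Rightarrow> ennreal" where
  "hausdorff_gauge s U =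
    (if U = {} then 0 else if s = 0 then 1 else ennreal (diameter U powr s))"

definition hausdorff_premeasure :: "real \<Rightarrow> real \<Rightarrow> 'a::metric_space set \<Rightarrow> ennreal" where
  "hausdorff_premeasure s \<delta> E =
    (INF U\<in>{U :: nat \<Rightarrow> 'a set. E \<subseteq> (\<Union>i. U i) \<and> (\<forall>i. bounded (U i) \<and> diameter (U i) \<le> \<delta>)}.
      \<Sum>i. hausdorff_gauge s (U i))"

definition hausdorff_measure :: "real \<Rightarrow> 'a::metric_space set \<Rightarrow> ennreal" where
  "hausdorff_measure s E = (SUP \<delta>\<in>{0<..}. hausdorff_premeasure s \<delta> E)"

definition hausdorff_dim :: "'a::metric_space set \<Rightarrow> ereal" where
  "hausdorff_dim E = Inf {ereal s | s. 0 \<le> s \<and> hausdorff_measure s E = 0}"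

definition porous :: "'a::metric_space set \<Rightarrow> bool" where
  "porous E \<longleftrightarrow> (\<exists>c. 0 < c \<and> c < 1 \<and>
    (\<forall>x\<in>E. \<forall>r. 0 < r \<and> ereal r < ediameter E \<longrightarrow>
      (\<exists>y. ball y (c * r) \<subseteq> ball x r - E)))"

end

theory Submission
  imports Defs
begin

text \<open>
  Let $E$ be the complement of $G$, let $\delta$ be the distance to $E$, and put $\tau = n - p + \beta$ and
  $s = (q/p) \tau$.  Assume that the second alternative fails, that is, the Hausdorff dimension (for
  $\beta \ge 0$) or the lower Minkowski dimension (for $\beta < 0$) of $E$ is below $\tau$.  The goal is
  $\overline{\dim}_A(E) < s$.  If $s > n$, this holds because no subset of the space has larger dimension
  than $n$.  So let $s < n$, which for $\beta < 0$ follows from $q < np/(n-p)$.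

  The first point is that $E$ is invisible to the weighted energy.  It has covers by balls with arbitrarily
  small $\sum_i r_i^\tau$ (\<open>fine_covers_hausdorff\<close>, \<open>fine_covers_minkowski\<close>), and a cutoff that
  vanishes near such a cover has weighted \<open>p\<close>-energy at most a constant times $\sum_i r_i^{\tau}$
  (\<open>gradient_cutoff_powr_bounded\<close>): the gradient has size $1/r_i$ on a ball of volume $r_i^n$, where the
  weight is at most a multiple of $r_i^\beta$.  Consequently the inequality may be tested with functions
  that do not vanish on $E$ (\<open>hardy_sobolev_ball\<close>).  The covers also show that $E$ is a
  null set, so that it coincides with the boundary of $G$.

  The test function for a ball $B(x,R)$ centred on $E$ is a bump of height $1$ on that ball.  Its energy
  is at most $C R^\tau$, whence
  \[ \int_{B(x,R)} \delta^{s-n} \, dy \le C R^s . \]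
  For $\beta \ge 0$ the energy bound is immediate (\<open>distance_integral_bound_nonneg\<close>).  For
  $\beta < 0$ it is not, and the displayed estimate is instead carried from each scale $2R$ to
  the scale $R$, starting above the diameter of $E$; subcriticality of $q$ is what keeps the constant
  from growing (\<open>distance_integral_bound_neg\<close>).

  Finally, the displayed estimate bounds the Assouad dimension strictly below $s$
  (\<open>assouad_dim_less\<close>).  If covering $E \cap B(x,R)$ by balls of radius $2^{-k} R$ needs $N_k$
  balls, then the volume near $E$ contributes at least a multiple of
  $R^s N_k 2^{-ks}$ to the integral at scale $k$.  The sum over $k$ being bounded, among boundedly many scales there is one at which
  $N_k \le 2^{ks}/2$.  Iterating such scales improves the exponent.
\<close>

section \<open>Smooth cutoff functions\<close>

lemma partial_deriv_eqI:
  assumes "(f has_derivative f') (at x)"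
  shows "partial_deriv i f x = f' (axis i 1)"
  using frechet_derivative_at[OF assms] by (simp add: partial_deriv_def)

lemma C_diff_SucI:
  assumes "\<And>x. (f has_derivative f' x) (at x)"
    and "\<And>i. C_diff k (\<lambda>x. f' x (axis i 1))"
  shows "C_diff (Suc k) f"
proof -
  have "partial_deriv i f = (\<lambda>x. f' x (axis i 1))" for i
    using partial_deriv_eqI[OF assms(1)] by blast
  then show ?thesis
    using assms by (auto simp: differentiable_def)
qed

lemma C_diff_mono_Suc: "C_diff (Suc k) f \<Longrightarrow> C_diff k f"
proof (induction k arbitrary: f)
  case 0
  then show ?case
    by (auto simp: continuous_on_eq_continuous_at intro: differentiable_imp_continuous_within)
qed auto

lemma C_diff_partial:
  assumes "C_diff (Suc k) f"
  shows "(f has_derivative frechet_derivative f (at x)) (at x)"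
    and "C_diff k (\<lambda>x. frechet_derivative f (at x) (axis i 1))"
  using assms by (auto simp: frechet_derivative_works[symmetric] partial_deriv_def[abs_def])

lemma C_diff_const: "C_diff k (\<lambda>x. c)"
proof (induction k arbitrary: c)
  case (Suc k)
  show ?case by (rule C_diff_SucI[where f' = "\<lambda>x v. 0"]) (auto simp: Suc)
qed auto

lemma C_diff_add: "C_diff k f \<Longrightarrow> C_diff k g \<Longrightarrow> C_diff k (\<lambda>x. f x + g x)"
proof (induction k arbitrary: f g)
  case (Suc k)
  show ?case
    by (rule C_diff_SucI[OF has_derivative_add[OF C_diff_partial(1)[OF Suc.prems(1)]
            C_diff_partial(1)[OF Suc.prems(2)]]])
      (intro Suc.IH C_diff_partial Suc.prems)
qed (auto intro: continuous_on_add)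

lemma C_diff_mult: "C_diff k f \<Longrightarrow> C_diff k g \<Longrightarrow> C_diff k (\<lambda>x. f x * g x)"
proof (induction k arbitrary: f g)
  case (Suc k)
  show ?case
    by (rule C_diff_SucI[OF has_derivative_mult[OF C_diff_partial(1)[OF Suc.prems(1)]
            C_diff_partial(1)[OF Suc.prems(2)]]])
      (intro C_diff_add Suc.IH C_diff_partial C_diff_mono_Suc[OF Suc.prems(1)]
        C_diff_mono_Suc[OF Suc.prems(2)] Suc.prems)
qed (auto intro: continuous_on_mult)

lemma C_diff_coord: "C_diff k (\<lambda>x. x $ j)"
proof (cases k)
  case (Suc l)
  have "C_diff (Suc l) (\<lambda>x::real^'a. x $ j)"
    by (rule C_diff_SucI[where f' = "\<lambda>x v. v $ j"])
      (auto intro!: bounded_linear_imp_has_derivative bounded_linear_vec_nth C_diff_const)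
  then show ?thesis using Suc by simp
qed (auto intro: continuous_intros)

lemma smooth_const: "smooth (\<lambda>x. c)"
  by (simp add: smooth_def C_diff_const)

lemma smooth_add: "smooth f \<Longrightarrow> smooth g \<Longrightarrow> smooth (\<lambda>x. f x + g x)"
  by (simp add: smooth_def C_diff_add)

lemma smooth_mult: "smooth f \<Longrightarrow> smooth g \<Longrightarrow> smooth (\<lambda>x. f x * g x)"
  by (simp add: smooth_def C_diff_mult)

lemma smooth_coord: "smooth (\<lambda>x. x $ j)"
  by (simp add: smooth_def C_diff_coord)

lemma smooth_diff: "smooth f \<Longrightarrow> smooth g \<Longrightarrow> smooth (\<lambda>x. f x - g x)"
  using smooth_add[OF _ smooth_mult[OF smooth_const[of "-1"]], of f g] by simp

lemma smooth_sum: "(\<And>i. i \<in> S \<Longrightarrow> smooth (f i)) \<Longrightarrow> smooth (\<lambda>x. \<Sum>i\<in>S. f i x)"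
  by (induction S rule: infinite_finite_induct) (auto intro: smooth_const smooth_add)

lemma smooth_power: "smooth f \<Longrightarrow> smooth (\<lambda>x. f x ^ m)"
  by (induction m) (auto intro: smooth_const smooth_mult)

lemma smooth_norm_sq: "smooth (\<lambda>y. (norm (y - c))\<^sup>2)"
proof -
  have "smooth (\<lambda>y. \<Sum>i\<in>UNIV. (y $ i - c $ i)\<^sup>2)"
    by (intro smooth_sum smooth_power smooth_diff smooth_coord smooth_const)
  then show ?thesis
    by (simp add: norm_vec_def L2_set_def sum_nonneg)
qed

lemma smooth_imp_continuous: "smooth f \<Longrightarrow> continuous_on UNIV f"
  unfolding smooth_def by (metis C_diff.simps(1))

lemma smooth_has_derivative: "smooth f \<Longrightarrow> (f has_derivative frechet_derivative f (at x)) (at x)"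
  unfolding smooth_def by (metis C_diff_partial(1))

lemma gradient_eqI:
  assumes "GDERIV f x :> D"
  shows "gradient f x = D"
  using assms unfolding gderiv_def gradient_def
  by (auto simp: vec_eq_iff partial_deriv_eqI inner_axis' inner_axis)

lemma smooth_GDERIV:
  assumes "smooth f"
  shows "GDERIV f x :> gradient f x"
proof -
  let ?f' = "frechet_derivative f (at x)"
  have d: "(f has_derivative ?f') (at x)" using smooth_has_derivative assms by blast
  then interpret bounded_linear ?f' by (rule has_derivative_bounded_linear)
  have "?f' h = h \<bullet> gradient f x" for h
  proof -
    have "?f' h = ?f' (\<Sum>i\<in>UNIV. (h $ i) *\<^sub>R axis i 1)"
      using basis_expansion[of h] by (simp add: scalar_mult_eq_scaleR)
    also have "\<dots> = (\<Sum>i\<in>UNIV. h $ i * ?f' (axis i 1))"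
      by (simp add: sum scaleR)
    finally show ?thesis
      by (simp add: inner_vec_def gradient_def partial_deriv_def)
  qed
  then show ?thesis using d unfolding gderiv_def by (metis (no_types, lifting) ext)
qed

text \<open>The functions $x^{-m} e^{-1/x}$, extended by zero to $x \le 0$.  The family is closed under
  differentiation up to linear combinations, which makes every member smooth by a single
  induction that ranges over all of them.\<close>

definition flat :: "nat \<Rightarrow> real \<Rightarrow> real" where
  "flat m x = (if x \<le> 0 then 0 else inverse x ^ m * exp (- inverse x))"

lemma flat_tendsto_0: "(flat m \<longlongrightarrow> 0) (at 0)"
proof -
  have "((\<lambda>y::real. y ^ m * exp (- y)) \<longlongrightarrow> 0) at_top"
    using tendsto_power_div_exp_0[of m] by (simp add: exp_minus field_simps)
  then have "((\<lambda>x. inverse x ^ m * exp (- inverse x)) \<longlongrightarrow> 0) (at_right (0::real))"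
    using filterlim_compose[OF _ filterlim_inverse_at_top_right] by fast
  moreover have "\<forall>\<^sub>F x in at_right 0. inverse x ^ m * exp (- inverse x) = flat m x"
    using eventually_at_right_less[of 0] by eventually_elim (simp add: flat_def)
  ultimately have "(flat m \<longlongrightarrow> 0) (at_right 0)"
    by (rule Lim_transform_eventually)
  moreover have "\<forall>\<^sub>F x in at_left 0. 0 = flat m x"
    by (simp add: eventually_at_filter flat_def)
  then have "(flat m \<longlongrightarrow> 0) (at_left 0)"
    by (rule Lim_transform_eventually[OF tendsto_const])
  ultimately show ?thesis by (simp add: filterlim_split_at)
qed

lemma flat_deriv: "DERIV (flat m) x :> flat (m + 2) x - m * flat (m + 1) x"
proof (rule linorder_cases[of x 0])
  assume x: "x < 0"
  have "DERIV (\<lambda>_. 0) x :> (0::real)" by simp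
  then have "DERIV (flat m) x :> 0"
    by (rule DERIV_cong_ev[THEN iffD1, rotated 3])
      (use x eventually_nhds_in_open[of "{..<0}" x] in
        \<open>auto simp: flat_def elim!: eventually_mono\<close>)
  then show ?thesis using x by (simp add: flat_def)
next
  assume x: "x = 0"
  have "\<forall>\<^sub>F h in at 0. flat (m + 1) h = (flat m (0 + h) - flat m 0) / h"
    by (auto simp: eventually_at_filter flat_def field_simps)
  then have "((\<lambda>h. (flat m (0 + h) - flat m 0) / h) \<longlongrightarrow> 0) (at 0)"
    by (rule Lim_transform_eventually[OF flat_tendsto_0])
  then have "DERIV (flat m) 0 :> 0" by (simp add: DERIV_def)
  then show ?thesis using x by (simp add: flat_def)
next
  assume x: "0 < x"
  have m: "m * inverse x ^ (m - 1) * (inverse x)\<^sup>2 = m * inverse x ^ (m + 1)"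
    by (cases m) (auto simp: power2_eq_square)
  have "DERIV (\<lambda>x. inverse x ^ m * exp (- inverse x)) x :>
      - (m * inverse x ^ (m - 1) * (inverse x)\<^sup>2) * exp (- inverse x)
      + inverse x ^ m * (exp (- inverse x) * (inverse x)\<^sup>2)"
    by (rule derivative_eq_intros refl | use x in \<open>simp add: power2_eq_square field_simps\<close>)+
  then have "DERIV (\<lambda>x. inverse x ^ m * exp (- inverse x)) x :>
      flat (m + 2) x - m * flat (m + 1) x"
    unfolding m using x by (simp add: flat_def power2_eq_square algebra_simps)
  then show ?thesis
    by (rule DERIV_cong_ev[THEN iffD1, rotated 3])
      (use x eventually_nhds_in_open[of "{0<..}" x] in
        \<open>auto simp: flat_def elim!: eventually_mono\<close>)
qed

lemma C_diff_flat: "C_diff k u \<Longrightarrow> C_diff k (\<lambda>x. flat m (u x))"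
proof (induction k arbitrary: m u)
  case 0
  have "continuous_on UNIV (flat m)"
    using flat_deriv by (meson DERIV_continuous continuous_at_imp_continuous_on)
  then show ?case
    using 0 by (auto intro: continuous_on_compose2)
next
  case (Suc k)
  note D = C_diff_partial[OF Suc.prems]
  have "((\<lambda>x. flat m (u x)) has_derivative
      (\<lambda>v. (flat (m + 2) (u x) + (- m) * flat (m + 1) (u x)) * frechet_derivative u (at x) v)) (at x)"
    for x
    using has_derivative_compose[OF D(1) flat_deriv[unfolded has_field_derivative_def]]
    by simp
  then show ?case
    by (rule C_diff_SucI)
      (intro C_diff_mult C_diff_add C_diff_const Suc.IH D C_diff_mono_Suc[OF Suc.prems])
qed

lemma flat_nonneg: "0 \<le> flat m x"
  by (simp add: flat_def)

lemma flat_0_pos_iff: "0 < flat 0 x \<longleftrightarrow> 0 < x"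
  by (simp add: flat_def)

lemma flat_0_mono: "x \<le> y \<Longrightarrow> flat 0 x \<le> flat 0 y"
  by (auto simp: flat_def)

lemma flat_2_le: "flat 2 x \<le> 2"
proof (cases "x \<le> 0")
  case False
  then have "0 \<le> inverse x" by simp
  then have "(inverse x)\<^sup>2 / 2 \<le> exp (inverse x)"
    using exp_lower_Taylor_quadratic[of "inverse x"] by linarith
  then show ?thesis using False by (simp add: flat_def exp_minus field_simps)
qed (simp add: flat_def)

text \<open>A smooth decreasing step without quotients or integrals: below \<open>a\<close> the inner function
  vanishes, so the outer argument is the constant \<open>M\<close>; above \<open>b\<close> the inner function is at
  least \<open>M\<close>, so the outer argument is nonpositive.\<close>

definition smooth_step :: "real \<Rightarrow> real \<Rightarrow> real \<Rightarrow> real" where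
  "smooth_step a b t = (let M = flat 0 (b - a) in flat 0 (M - flat 0 (t - a)) / flat 0 M)"

definition smooth_step_deriv :: "real \<Rightarrow> real \<Rightarrow> real \<Rightarrow> real" where
  "smooth_step_deriv a b t =
    (let M = flat 0 (b - a) in - (flat 2 (M - flat 0 (t - a)) * flat 2 (t - a)) / flat 0 M)"

lemma smooth_step_deriv: "DERIV (smooth_step a b) t :> smooth_step_deriv a b t"
proof -
  let ?M = "flat 0 (b - a)"
  have flat': "DERIV (flat 0) x :> flat 2 x" for x
    using flat_deriv[of 0 x] by (simp add: numeral_2_eq_2)
  have "DERIV (\<lambda>t. flat 0 (?M - flat 0 (t - a))) t :>
      flat 2 (?M - flat 0 (t - a)) * - (flat 2 (t - a) * 1)"
    by (rule DERIV_chain2[OF flat'] derivative_eq_intros refl | simp)+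
  from DERIV_cdivide[OF this, of "flat 0 ?M"] show ?thesis
    by (simp add: smooth_step_def[abs_def] smooth_step_deriv_def Let_def)
qed

lemma smooth_smooth_step: "smooth u \<Longrightarrow> smooth (\<lambda>x. smooth_step a b (u x))"
  unfolding smooth_step_def smooth_def Let_def divide_inverse
  by (intro allI C_diff_mult C_diff_flat C_diff_const C_diff_add
      C_diff_add[OF _ C_diff_mult[OF C_diff_const[of _ "-1"]], simplified]) auto

lemma smooth_step_eq_1: "a < b \<Longrightarrow> t \<le> a \<Longrightarrow> smooth_step a b t = 1"
  by (auto simp: smooth_step_def Let_def flat_def)

lemma smooth_step_eq_0: "a < b \<Longrightarrow> b \<le> t \<Longrightarrow> smooth_step a b t = 0"
  using flat_0_mono[of "b - a" "t - a"] by (simp add: smooth_step_def Let_def flat_def[of 0 "_ - flat _ _"])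

lemma smooth_step_bounds: "0 \<le> smooth_step a b t" "smooth_step a b t \<le> 1"
  using flat_0_mono[of "flat 0 (b - a) - flat 0 (t - a)" "flat 0 (b - a)"] flat_nonneg[of 0 "t - a"]
  by (auto simp: smooth_step_def Let_def flat_nonneg divide_le_eq_1
      dest: order_antisym[OF _ flat_nonneg] intro: order_neq_le_trans[OF not_sym])

lemma smooth_step_deriv_eq_0:
  "a < b \<Longrightarrow> t \<le> a \<or> b \<le> t \<Longrightarrow> smooth_step_deriv a b t = 0"
  using flat_0_mono[of "b - a" "t - a"]
  by (auto simp: smooth_step_deriv_def Let_def flat_def[of 2])

lemma smooth_step_deriv_bounded:
  assumes "a < b"
  obtains L where "0 < L" "\<And>t. \<bar>smooth_step_deriv a b t\<bar> \<le> L"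
proof
  let ?M = "flat 0 (b - a)"
  have M: "0 < flat 0 ?M" using assms by (simp add: flat_0_pos_iff)
  then show "0 < 4 / flat 0 ?M" by simp
  fix t
  have "flat 2 (?M - flat 0 (t - a)) * flat 2 (t - a) \<le> 2 * 2"
    by (intro mult_mono flat_2_le flat_nonneg) auto
  then show "\<bar>smooth_step_deriv a b t\<bar> \<le> 4 / flat 0 ?M"
    using M by (simp add: smooth_step_deriv_def Let_def abs_mult flat_nonneg divide_right_mono)
qed

definition bump :: "real ^ 'n::finite \<Rightarrow> real \<Rightarrow> real ^ 'n \<Rightarrow> real" where
  "bump c r y = smooth_step 1 4 ((norm (y - c))\<^sup>2 * inverse (r\<^sup>2))"

lemma smooth_bump: "smooth (bump c r)"
  unfolding bump_def[abs_def] by (intro smooth_smooth_step smooth_mult smooth_norm_sq smooth_const)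

lemma bump_bounds: "0 \<le> bump c r y" "bump c r y \<le> 1"
  by (simp_all add: bump_def smooth_step_bounds)

lemma bump_eq_1: "0 < r \<Longrightarrow> dist c y \<le> r \<Longrightarrow> bump c r y = 1"
  unfolding bump_def
  by (rule smooth_step_eq_1) (auto simp: field_simps dist_norm norm_minus_commute)

lemma four_le_scaled_norm:
  fixes y c :: "'a::real_normed_vector"
  assumes "0 < r" "2 * r \<le> dist c y" shows "4 \<le> (norm (y - c))\<^sup>2 * inverse (r\<^sup>2)"
  using assms power_mono[of "2 * r" "norm (y - c)" 2]
  by (auto simp: field_simps dist_norm norm_minus_commute power_mult_distrib)

lemma bump_eq_0: "0 < r \<Longrightarrow> 2 * r \<le> dist c y \<Longrightarrow> bump c r y = 0"
  unfolding bump_def by (rule smooth_step_eq_0) (auto intro: four_le_scaled_norm)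

lemma gradient_bump:
  "gradient (bump c r) y =
    (smooth_step_deriv 1 4 ((norm (y - c))\<^sup>2 * inverse (r\<^sup>2)) * (2 * inverse (r\<^sup>2))) *\<^sub>R (y - c)"
proof -
  have "GDERIV (\<lambda>y. (norm (y - c))\<^sup>2 * inverse (r\<^sup>2)) y :> (2 * inverse (r\<^sup>2)) *\<^sub>R (y - c)"
    unfolding gderiv_def power2_norm_eq_inner
    by (auto intro!: derivative_eq_intros simp: algebra_simps inner_commute)
  from gradient_eqI[OF GDERIV_DERIV_compose[OF this smooth_step_deriv]]
  show ?thesis by (simp add: bump_def[abs_def])
qed

text \<open>The constant is uniform in the centre and the radius because every bump is a
  translated and dilated copy of a single one.\<close>

lemma gradient_bump_bounded:
  obtains L where "0 < L"
    "\<And>(c::real^'n::finite) r y. 0 < r \<Longrightarrow> norm (gradient (bump c r) y) \<le> L / r * indicator (ball c (2 * r) - ball c r) y"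
proof -
  obtain L where L: "0 < L" "\<And>t. \<bar>smooth_step_deriv 1 4 t\<bar> \<le> L"
    using smooth_step_deriv_bounded[of 1 4] by auto
  have "norm (gradient (bump c r) y) \<le> 4 * L / r * indicator (ball c (2 * r) - ball c r) y"
    if r: "0 < r" for c y :: "real^'n" and r
  proof (cases "y \<in> ball c (2 * r) - ball c r")
    case True
    have "\<bar>smooth_step_deriv 1 4 ((norm (y - c))\<^sup>2 * inverse (r\<^sup>2))\<bar> * (2 * inverse (r\<^sup>2)) * norm (y - c)
      \<le> L * (2 * inverse (r\<^sup>2)) * (2 * r)"
      using True r L by (intro mult_mono L) (auto simp: dist_norm norm_minus_commute)
    moreover have "L * (2 * inverse (r\<^sup>2)) * (2 * r) = 4 * L / r"
      using r by (simp add: power2_eq_square field_simps)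
    ultimately show ?thesis
      using True by (simp add: gradient_bump abs_mult)
  next
    case False
    then have "4 \<le> (norm (y - c))\<^sup>2 * inverse (r\<^sup>2) \<or> (norm (y - c))\<^sup>2 * inverse (r\<^sup>2) \<le> 1"
      using r four_le_scaled_norm[OF r, of c y]
      by (auto simp: field_simps dist_norm norm_minus_commute)
    then show ?thesis using False by (auto simp: gradient_bump smooth_step_deriv_eq_0)
  qed
  then show ?thesis using that[of "4 * L"] L(1) by auto
qed

section \<open>Cutoffs adapted to a cover by balls\<close>

text \<open>Jensen's inequality for the convex function $t^p$: weights of total mass below \<open>1\<close> are admissible
  because the missing mass can be placed at \<open>0\<close>.\<close>

lemma powr_weighted_sum_le:
  fixes w t :: "'a \<Rightarrow> real"
  assumes p: "1 \<le> p" and S: "finite S" and w: "\<And>i. i \<in> S \<Longrightarrow> 0 \<le> w i" "sum w S \<le> 1"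
    and t: "\<And>i. i \<in> S \<Longrightarrow> 0 \<le> t i"
  shows "(\<Sum>i\<in>S. w i * t i) powr p \<le> (\<Sum>i\<in>S. w i * t i powr p)"
proof -
  define T where "T = {i \<in> S. 0 < t i}"
  define W where "W = sum w T"
  have T: "finite T" "T \<subseteq> S" using S by (auto simp: T_def)
  have restrict: "(\<Sum>i\<in>S. w i * g (t i)) = (\<Sum>i\<in>T. w i * g (t i))" if "g 0 = 0" for g :: "real \<Rightarrow> real"
  proof (rule sum.mono_neutral_right[OF S T(2)], rule ballI)
    fix i assume "i \<in> S - T"
    then have "t i = 0" using t by (auto simp: T_def intro: order_antisym)
    then show "w i * g (t i) = 0" using that by simp
  qed
  have W: "0 \<le> W" "W \<le> 1"
    using w T sum_mono2[OF S T(2), of w] by (auto simp: W_def intro: sum_nonneg)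
  have "(\<Sum>i\<in>T. w i * t i) powr p \<le> (\<Sum>i\<in>T. w i * t i powr p)"
  proof (cases "W = 0")
    case True
    then have "w i = 0" if "i \<in> T" for i
      using that w T by (auto simp: W_def sum_nonneg_eq_0_iff subset_iff)
    then show ?thesis by simp
  next
    case False
    then have "T \<noteq> {}" by (auto simp: W_def)
    then have "(\<Sum>i\<in>T. (w i / W) *\<^sub>R t i) powr p \<le> (\<Sum>i\<in>T. (w i / W) * t i powr p)"
      using T W False w
      by (intro convex_on_sum[OF T(1) _ powr_convex[OF p]])
        (auto simp: T_def W_def simp flip: sum_divide_distrib)
    moreover have "(\<Sum>i\<in>T. w i * t i) = W * (\<Sum>i\<in>T. (w i / W) *\<^sub>R t i)"
      "(\<Sum>i\<in>T. w i * t i powr p) = W * (\<Sum>i\<in>T. (w i / W) * t i powr p)"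
      using False by (simp_all add: sum_distrib_left)
    moreover have "W powr p \<le> W powr 1"
      using W p by (intro powr_mono') auto
    moreover have "0 \<le> (\<Sum>i\<in>T. (w i / W) *\<^sub>R t i)"
      using W w t T by (auto intro!: sum_nonneg)
    ultimately show ?thesis
      using W False by (auto simp: powr_mult intro!: mult_mono)
  qed
  then show ?thesis
    using restrict[of "\<lambda>x. x"] restrict[of "\<lambda>x. x powr p"] p by simp
qed

text \<open>A smooth function that vanishes on the balls of a family and is \<open>1\<close> away from the doubled balls.
  The sum of \<open>m\<close>-th powers is a smooth substitute for the maximum of the bumps; a large
  \<open>m\<close> makes its gradient behave like that of a maximum.\<close>

definition cutoff ::
  "nat \<Rightarrow> 'a set \<Rightarrow> ('a \<Rightarrow> real ^ 'n::finite) \<Rightarrow> ('a \<Rightarrow> real) \<Rightarrow> real ^ 'n \<Rightarrow> real" where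
  "cutoff m S c r y = smooth_step 0 1 (\<Sum>i\<in>S. bump (c i) (r i) y ^ m)"

lemma smooth_cutoff: "smooth (cutoff m S c r)"
  unfolding cutoff_def[abs_def] by (intro smooth_smooth_step smooth_sum smooth_power smooth_bump)

lemma cutoff_bounds: "0 \<le> cutoff m S c r y" "cutoff m S c r y \<le> 1"
  by (simp_all add: cutoff_def smooth_step_bounds)

lemma cutoff_eq_1:
  assumes "\<And>i. i \<in> S \<Longrightarrow> 0 < r i" "\<And>i. i \<in> S \<Longrightarrow> y \<notin> ball (c i) (2 * r i)" "0 < m"
  shows "cutoff m S c r y = 1"
proof -
  have "(\<Sum>i\<in>S. bump (c i) (r i) y ^ m) = 0"
    using assms bump_eq_0[of "r _" "c _" y] by (intro sum.neutral) (auto simp: not_less)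
  then show ?thesis by (simp add: cutoff_def smooth_step_eq_1)
qed

lemma one_le_sum_bumps:
  assumes "finite S" "i \<in> S" "0 < r i" "y \<in> ball (c i) (r i)"
  shows "1 \<le> (\<Sum>i\<in>S. bump (c i) (r i) y ^ m)"
proof -
  have "1 = bump (c i) (r i) y ^ m" using bump_eq_1[of "r i" "c i" y] assms by auto
  also have "\<dots> \<le> (\<Sum>i\<in>S. bump (c i) (r i) y ^ m)"
    using assms by (intro member_le_sum) (auto simp: bump_bounds)
  finally show ?thesis .
qed

lemma cutoff_eq_0:
  assumes "finite S" "i \<in> S" "0 < r i" "y \<in> ball (c i) (r i)"
  shows "cutoff m S c r y = 0"
  using one_le_sum_bumps[of S i r y c m, OF assms] by (simp add: cutoff_def smooth_step_eq_0)

lemma gradient_cutoff: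
  assumes "finite S"
  shows "gradient (cutoff m S c r) y = smooth_step_deriv 0 1 (\<Sum>i\<in>S. bump (c i) (r i) y ^ m) *\<^sub>R
    (\<Sum>i\<in>S. (m * bump (c i) (r i) y ^ (m - 1)) *\<^sub>R gradient (bump (c i) (r i)) y)"
proof -
  have "GDERIV (\<lambda>y. \<Sum>i\<in>S. bump (c i) (r i) y ^ m) y :>
    (\<Sum>i\<in>S. (m * bump (c i) (r i) y ^ (m - 1)) *\<^sub>R gradient (bump (c i) (r i)) y)"
    using assms
  proof (induction S)
    case (insert i S)
    have "GDERIV (\<lambda>y. bump (c i) (r i) y ^ m) y :>
        (m * bump (c i) (r i) y ^ (m - 1)) *\<^sub>R gradient (bump (c i) (r i)) y"
      using GDERIV_DERIV_compose[OF smooth_GDERIV[OF smooth_bump]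
          DERIV_pow[of m "bump (c i) (r i) y" UNIV]] by simp
    from GDERIV_add[OF this insert.IH] show ?case
      using insert.hyps by simp
  qed (simp add: GDERIV_const)
  from gradient_eqI[OF GDERIV_DERIV_compose[OF this smooth_step_deriv]]
  show ?thesis by (simp add: cutoff_def[abs_def])
qed

text \<open>The doubled balls may overlap arbitrarily often, so summing the gradients of the bumps and taking
  \<open>p\<close>-th powers afterwards would lose too much.  Where the cutoff is not constant, however, the numbers
  $b_i^m$ (with $b_i$ the bumps) have sum at most \<open>1\<close>, and
  $b_i^{m-1} |\nabla b_i| = b_i^m \cdot |\nabla b_i| / b_i$.  Jensen's inequality with the weights
  $b_i^m$ moves the power inside the sum, and $b_i^{m-p} \le 1$ absorbs the denominators.
  The \<open>p\<close>-energy is thus additive over the balls.\<close>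

lemma gradient_cutoff_powr_bounded:
  assumes p: "1 \<le> p" and m: "p \<le> real m" "2 \<le> m"
  shows "\<exists>L>0. \<forall>(S::'a set) (c::'a \<Rightarrow> real^'n::finite) r y. finite S \<longrightarrow> (\<forall>i\<in>S. 0 < r i) \<longrightarrow>
      norm (gradient (cutoff m S c r) y) powr p
      \<le> L * (\<Sum>i\<in>S. r i powr - p * indicator (ball (c i) (2 * r i) - (\<Union>j\<in>S. ball (c j) (r j))) y)"
proof -
  obtain L1 where L1: "0 < L1" "\<And>t. \<bar>smooth_step_deriv 0 1 t\<bar> \<le> L1"
    using smooth_step_deriv_bounded[of 0 1] by auto
  obtain L2 where L2: "0 < L2" "\<And>(c::real^'n) r y. 0 < r \<Longrightarrow>
      norm (gradient (bump c r) y) \<le> L2 / r * indicator (ball c (2 * r) - ball c r) y"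
    using gradient_bump_bounded by blast
  define L where "L = (L1 * m) powr p * L2 powr p"
  have main: "norm (gradient (cutoff m S c r) y) powr p
      \<le> L * (\<Sum>i\<in>S. r i powr - p * indicator (ball (c i) (2 * r i) - (\<Union>j\<in>S. ball (c j) (r j))) y)"
    (is "_ \<le> L * ?R")
    if S: "finite S" and r: "\<And>i. i \<in> S \<Longrightarrow> 0 < r i" for S c and r :: "'a \<Rightarrow> real" and y :: "real^'n"
  proof (cases "1 \<le> (\<Sum>i\<in>S. bump (c i) (r i) y ^ m)")
    case True
    then have "gradient (cutoff m S c r) y = 0"
      using S by (simp add: gradient_cutoff smooth_step_deriv_eq_0)
    then show ?thesis using p by (auto simp: L_def intro!: mult_nonneg_nonneg sum_nonneg)
  next
    case False
    define b where "b i = bump (c i) (r i) y" for i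
    define g where "g i = norm (gradient (bump (c i) (r i)) y)" for i
    have b: "0 \<le> b i" "b i \<le> 1" for i by (simp_all add: b_def bump_bounds)
    have sum_b: "(\<Sum>i\<in>S. b i ^ m) \<le> 1" using False by (simp add: b_def)
    have y: "y \<notin> ball (c j) (r j)" if "j \<in> S" for j
      using one_le_sum_bumps[of S j r y c m] S that r False by blast
    have "norm (gradient (cutoff m S c r) y) \<le> L1 * (\<Sum>i\<in>S. norm ((m * b i ^ (m - 1)) *\<^sub>R gradient (bump (c i) (r i)) y))"
      unfolding gradient_cutoff[OF S] b_def
      using L1 by (subst norm_scaleR) (intro mult_mono norm_sum; simp)
    also have "\<dots> = L1 * m * (\<Sum>i\<in>S. b i ^ (m - 1) * g i)"
      by (simp add: g_def sum_distrib_left abs_mult b mult_ac)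
    also have "(\<Sum>i\<in>S. b i ^ (m - 1) * g i) = (\<Sum>i\<in>S. b i ^ m * (g i / b i))"
    proof (rule sum.cong[OF refl])
      fix i assume "i \<in> S"
      show "b i ^ (m - 1) * g i = b i ^ m * (g i / b i)"
        using m by (cases "b i = 0"; cases m) auto
    qed
    finally have "norm (gradient (cutoff m S c r) y) powr p
        \<le> (L1 * m * (\<Sum>i\<in>S. b i ^ m * (g i / b i))) powr p"
      using p by (intro powr_mono2) auto
    also have "\<dots> = (L1 * m) powr p * (\<Sum>i\<in>S. b i ^ m * (g i / b i)) powr p"
      by (rule powr_mult)
    also have "\<dots> \<le> (L1 * m) powr p * (\<Sum>i\<in>S. b i ^ m * (g i / b i) powr p)"
      using b sum_b by (intro mult_left_mono powr_weighted_sum_le p S) (auto simp: g_def)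
    also have "\<dots> \<le> (L1 * m) powr p * (\<Sum>i\<in>S. L2 powr p * (r i powr - p * indicator (ball (c i) (2 * r i) - (\<Union>j\<in>S. ball (c j) (r j))) y))"
    proof (intro mult_left_mono sum_mono)
      fix i assume i: "i \<in> S"
      have "b i ^ m * (g i / b i) powr p \<le> g i powr p"
      proof (cases "b i = 0")
        case False
        then have bi: "0 < b i" using b[of i] by simp
        have "b i ^ m * (g i / b i) powr p = b i powr (m - p) * g i powr p"
          using bi by (simp add: powr_divide g_def powr_diff powr_realpow)
        also have "\<dots> \<le> 1 * g i powr p"
          using bi b[of i] m by (intro mult_right_mono powr_le1) auto
        finally show ?thesis by simp
      qed (use p in simp)
      also have "\<dots> \<le> (L2 / r i * indicator (ball (c i) (2 * r i)) y) powr p"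
        unfolding g_def using L2(2)[OF r[OF i], of "c i" y] p y[OF i]
        by (intro powr_mono2) (auto simp: indicator_def split: if_splits)
      also have "\<dots> = L2 powr p * (r i powr - p * indicator (ball (c i) (2 * r i) - (\<Union>j\<in>S. ball (c j) (r j))) y)"
        using L2(1) r[OF i] p y by (auto simp: indicator_def powr_divide powr_minus_divide)
      finally show "b i ^ m * (g i / b i) powr p \<le> \<dots>" .
    qed auto
    also have "\<dots> = L * ?R" by (simp add: L_def sum_distrib_left mult_ac)
    finally show ?thesis .
  qed
  have "0 < L" using L1 L2 m by (simp add: L_def)
  then show ?thesis using main by (intro exI[of _ L]) simp
qed

section \<open>Testing the inequality\<close>

lemma infdist_geI: "E \<noteq> {} \<Longrightarrow> (\<And>z. z \<in> E \<Longrightarrow> r \<le> dist y z) \<Longrightarrow> r \<le> infdist y E"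
  unfolding infdist_def by (simp add: cINF_greatest)

lemma closed_infdist_ge: "closed {y. \<rho> \<le> infdist y E}"
  by (intro closed_Collect_le continuous_intros)

lemma set_integrable_infdist_powr:
  fixes U E :: "'a::euclidean_space set"
  assumes U: "bounded U" "U \<in> sets borel" and \<rho>: "0 < \<rho>"
  shows "set_integrable lborel {y \<in> U. \<rho> \<le> infdist y E} (\<lambda>y. infdist y E powr t)"
proof -
  obtain B where B: "U \<subseteq> cball 0 B" using U by (auto simp: bounded_iff subset_iff)
  let ?K = "cball 0 B \<inter> {y. \<rho> \<le> infdist y E}"
  have "compact ?K" by (intro compact_Int_closed closed_infdist_ge) simp
  moreover have "continuous_on ?K (\<lambda>y. infdist y E powr t)"
    using \<rho> by (intro continuous_intros) auto
  ultimately have "set_integrable lborel ?K (\<lambda>y. infdist y E powr t)"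
    unfolding set_integrable_def by (rule borel_integrable_compact)
  moreover have "{y \<in> U. \<rho> \<le> infdist y E} = U \<inter> {y. \<rho> \<le> infdist y E}" by auto
  ultimately show ?thesis
    using B U borel_closed[OF closed_infdist_ge[of \<rho> E]]
    by (auto intro: set_integrable_subset)
qed

text \<open>The inequality with its two sides replaced by quantities that can be computed: a lower bound
  for \<open>f\<close> on a set, and an integrable majorant of the weighted gradient.\<close>

lemma hardy_sobolev_test:
  fixes G :: "(real ^ 'n::finite) set" and p q \<beta> :: real
  defines "\<sigma> \<equiv> q / p * (real CARD('n) - p + \<beta>) - real CARD('n)"
  assumes hs: "hardy_sobolev q p \<beta> G" and G: "open G" "frontier G \<noteq> {}" and p: "0 < p" "0 < q"
  obtains C where "0 < C" "\<And>f A B. f \<in> test_functions G \<Longrightarrow> A \<subseteq> G \<Longrightarrow> (\<And>y. y \<in> A \<Longrightarrow> 1 \<le> \<bar>f y\<bar>) \<Longrightarrow>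
    integrable lborel B \<Longrightarrow> (\<And>y. 0 \<le> B y) \<Longrightarrow>
    (\<And>y. y \<in> G \<Longrightarrow> norm (gradient f y) powr p * infdist y (frontier G) powr \<beta> \<le> B y) \<Longrightarrow>
    (LINT y:A|lborel. infdist y (frontier G) powr \<sigma>) \<le> C * (LINT y|lborel. B y) powr (q / p)"
proof -
  let ?d = "\<lambda>y. infdist y (frontier G)"
  from hs obtain C where C: "0 < C" "\<And>f. f \<in> test_functions G \<Longrightarrow>
    (LINT x:G|lborel. \<bar>f x\<bar> powr q * ?d x powr \<sigma>) powr (1 / q)
      \<le> C * (LINT x:G|lborel. norm (gradient f x) powr p * ?d x powr \<beta>) powr (1 / p)"
    unfolding hardy_sobolev_def \<sigma>_def by blast
  have main: "(LINT y:A|lborel. ?d y powr \<sigma>) \<le> C powr q * (LINT y|lborel. B y) powr (q / p)"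
    if f: "f \<in> test_functions G" and A: "A \<subseteq> G" "\<And>y. y \<in> A \<Longrightarrow> 1 \<le> \<bar>f y\<bar>"
      and B: "integrable lborel B" "\<And>y. 0 \<le> B y"
        "\<And>y. y \<in> G \<Longrightarrow> norm (gradient f y) powr p * ?d y powr \<beta> \<le> B y" for f A B
  proof -
    define F where "F = (\<lambda>x. \<bar>f x\<bar> powr q * ?d x powr \<sigma>)"
    define K where "K = closure {x. f x \<noteq> 0}"
    have K: "compact K" "K \<subseteq> G" and sm: "smooth f"
      using f by (auto simp: test_functions_def K_def)
    have pos: "0 < ?d x" if "x \<in> K" for x
    proof -
      have "x \<notin> frontier G" using that K G by (auto simp: frontier_def interior_open)
      then show ?thesis
        using G(2) in_closed_iff_infdist_zero[OF frontier_closed G(2), of x] infdist_nonneg[of x "frontier G"]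
        by linarith
    qed
    have "continuous_on K F"
      unfolding F_def
    proof (intro continuous_on_mult)
      show "continuous_on K (\<lambda>x. \<bar>f x\<bar> powr q)"
        using p continuous_on_subset[OF smooth_imp_continuous[OF sm], of K]
        by (intro continuous_on_powr' continuous_intros) auto
      show "continuous_on K (\<lambda>x. ?d x powr \<sigma>)"
        using pos by (intro continuous_intros) (auto dest: pos)
    qed
    from borel_integrable_compact[OF K(1) this]
    have "integrable lborel (\<lambda>x. indicator K x *\<^sub>R F x)" .
    moreover have "(\<lambda>x. indicator K x *\<^sub>R F x) = (\<lambda>x. indicator G x *\<^sub>R F x)"
    proof
      fix x
      show "indicator K x *\<^sub>R F x = indicator G x *\<^sub>R F x"
        using K closure_subset[of "{x. f x \<noteq> 0}"] p by (auto simp: indicator_def F_def K_def)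
    qed
    ultimately have F: "integrable lborel (\<lambda>x. indicator G x *\<^sub>R F x)" by metis
    have "(LINT y:A|lborel. ?d y powr \<sigma>) \<le> (LINT x:G|lborel. F x)" (is "?a \<le> ?F")
      unfolding set_lebesgue_integral_def
    proof (rule integral_mono'[OF F])
      fix y
      show "indicator A y *\<^sub>R ?d y powr \<sigma> \<le> indicator G y *\<^sub>R F y"
        using A ge_one_powr_ge_zero[of "\<bar>f y\<bar>" q] p
        by (auto simp: indicator_def F_def mult_le_cancel_right1)
    qed (simp add: F_def)
    moreover have "0 \<le> ?a"
      unfolding set_lebesgue_integral_def by (rule integral_nonneg_AE) auto
    ultimately have "?a powr (1 / q) \<le> ?F powr (1 / q)"
      using p by (intro powr_mono2) auto
    also have "\<dots> \<le> C * (LINT x:G|lborel. norm (gradient f x) powr p * ?d x powr \<beta>) powr (1 / p)"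
      unfolding F_def by (rule C(2)[OF f])
    also have "\<dots> \<le> C * (LINT y|lborel. B y) powr (1 / p)"
      unfolding set_lebesgue_integral_def using B C(1) p
      by (intro mult_left_mono powr_mono2 integral_mono' integral_nonneg_AE)
        (auto simp: indicator_def)
    finally have "(?a powr (1 / q)) powr q \<le> (C * (LINT y|lborel. B y) powr (1 / p)) powr q"
      using p by (intro powr_mono2) auto
    then show ?thesis
      using p C(1) \<open>0 \<le> ?a\<close> by (simp add: powr_powr powr_mult)
  qed
  have "0 < C powr q" using C by simp
  then show ?thesis by (rule that[OF _ main])
qed

text \<open>Covers by balls of small total \<open>\<tau>\<close>-content.  The last clause bounds the weight
  $\delta^\beta$ where the cutoff of such a cover varies; the balls themselves are
  removed there because for $\beta < 0$ the weight blows up at \<open>E\<close>.\<close>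

definition fine_covers :: "real \<Rightarrow> real \<Rightarrow> real \<Rightarrow> 'a::metric_space set \<Rightarrow> bool" where
  "fine_covers K \<tau> \<beta> E \<longleftrightarrow> (\<forall>\<epsilon>>0. \<forall>x. \<forall>\<rho>. \<exists>P. finite P \<and>
    (\<forall>(c, r)\<in>P. c \<in> E \<and> 0 < r \<and> r < \<epsilon>) \<and>
    E \<inter> cball x \<rho> \<subseteq> (\<Union>(c, r)\<in>P. ball c r) \<and>
    (\<Sum>(c, r)\<in>P. r powr \<tau>) \<le> \<epsilon> \<and>
    (\<forall>(c, r)\<in>P. \<forall>y\<in>ball c (2 * r) - (\<Union>(c, r)\<in>P. ball c r) - E.
      infdist y E powr \<beta> \<le> K * r powr \<beta>))"

lemma powr_sum_le:
  fixes a b p :: real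
  assumes "0 \<le> a" "0 \<le> b" "0 \<le> p"
  shows "(a + b) powr p \<le> 2 powr p * (a powr p + b powr p)"
proof -
  have "(a + b) powr p \<le> (2 * max a b) powr p" using assms by (intro powr_mono2) auto
  also have "\<dots> = 2 powr p * (max a b) powr p" using assms by (simp add: powr_mult)
  also have "\<dots> \<le> 2 powr p * (a powr p + b powr p)" by (intro mult_left_mono) (auto simp: max_def)
  finally show ?thesis .
qed

text \<open>Test the inequality with a bump that is \<open>1\<close> on the ball of radius \<open>R\<close>, multiplied by the cutoff of a
  fine cover of the part of \<open>E\<close> in the support of the bump.  The product has compact support away
  from \<open>E\<close>.  The cutoff contributes to the energy a multiple of the sum of the \<open>\<tau>\<close>-th powers
  of the radii, which is at most $R^\tau$, the size of the energy of the bump.  If moreover the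
  radii are below \<open>\<eta> / 2\<close>, then the cutoff is \<open>1\<close> wherever $\delta \ge \eta$, so that nothing
  is lost on the left-hand side.  The truncation at \<open>\<eta>\<close> keeps every integral finite.\<close>

lemma hardy_sobolev_ball:
  fixes E :: "(real ^ 'n::finite) set" and p q \<beta> K :: real
  defines "n \<equiv> real CARD('n)"
  defines "\<tau> \<equiv> n - p + \<beta>"
  defines "\<sigma> \<equiv> q / p * \<tau> - n"
  assumes hs: "hardy_sobolev q p \<beta> (- E)" and E: "closed E" "E \<noteq> {}" "frontier E = E"
    and p: "1 \<le> p" "p \<le> q" and K: "0 \<le> K" "fine_covers K \<tau> \<beta> E"
  obtains C where "0 < C" "\<And>x R D \<eta>. 0 < R \<Longrightarrow> 0 < \<eta> \<Longrightarrow> 0 \<le> D \<Longrightarrow>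
    (\<And>\<rho>. 0 < \<rho> \<Longrightarrow> (LINT y:{y \<in> ball x (2 * R) - ball x R. \<rho> \<le> infdist y E}|lborel.
        infdist y E powr \<beta>) \<le> D * R powr (n + \<beta>)) \<Longrightarrow>
    (LINT y:{y \<in> ball x R. \<eta> \<le> infdist y E}|lborel. infdist y E powr \<sigma>)
      \<le> C * (D + 1) powr (q / p) * R powr (n + \<sigma>)"
proof -
  let ?d = "\<lambda>y. infdist y E"
  define \<omega> where "\<omega> = measure lborel (ball (0 :: real ^ 'n) 1)"
  have \<omega>: "0 \<le> \<omega>" by (simp add: \<omega>_def)
  have vol: "measure lborel (ball c r) = \<omega> * r powr n" if "0 < r" for c :: "real ^ 'n" and r
    using that content_ball_conv_unit_ball[of r c] by (simp add: \<omega>_def n_def powr_realpow)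
  have fG: "frontier (- E) = E" using E by simp
  have E': "open (- E)" and p': "0 < p" "0 < q" using E p by auto
  obtain C0 where C0: "0 < C0" "\<And>f A B. f \<in> test_functions (- E) \<Longrightarrow> A \<subseteq> - E \<Longrightarrow> (\<And>y. y \<in> A \<Longrightarrow> 1 \<le> \<bar>f y\<bar>) \<Longrightarrow>
    integrable lborel B \<Longrightarrow> (\<And>y. 0 \<le> B y) \<Longrightarrow>
    (\<And>y. y \<in> - E \<Longrightarrow> norm (gradient f y) powr p * ?d y powr \<beta> \<le> B y) \<Longrightarrow>
    (LINT y:A|lborel. ?d y powr \<sigma>) \<le> C0 * (LINT y|lborel. B y) powr (q / p)"
    by (rule hardy_sobolev_test[OF hs, unfolded fG, folded n_def, folded \<tau>_def, folded \<sigma>_def,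
          OF E' E(2) p'])
      (rule that, assumption, blast)
  obtain m :: nat where m: "p \<le> real m" "2 \<le> m"
    using real_arch_simple[of "max p 2"] by (metis max.bounded_iff of_nat_le_iff of_nat_numeral)
  obtain L1 where L1: "0 < L1" "\<And>(c::real^'n) r y. 0 < r \<Longrightarrow>
      norm (gradient (bump c r) y) \<le> L1 / r * indicator (ball c (2 * r) - ball c r) y"
    using gradient_bump_bounded by blast
  obtain L2 where L2: "0 < L2"
    "\<forall>(S::((real^'n) \<times> real) set) (c::_ \<Rightarrow> real^'n) r y. finite S \<longrightarrow> (\<forall>i\<in>S. 0 < r i) \<longrightarrow>
      norm (gradient (cutoff m S c r) y) powr p
      \<le> L2 * (\<Sum>i\<in>S. r i powr - p * indicator (ball (c i) (2 * r i) - (\<Union>j\<in>S. ball (c j) (r j))) y)"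
    using gradient_cutoff_powr_bounded[OF p(1) m] by (elim exE conjE) (rule that)
  define C1 where "C1 = 2 powr p * (L2 * K * \<omega> * 2 powr n + L1 powr p)"
  have C1: "0 < C1" using L1 L2 K \<omega> by (simp add: C1_def add_nonneg_pos)
  have main: "(LINT y:{y \<in> ball x R. \<eta> \<le> ?d y}|lborel. ?d y powr \<sigma>)
      \<le> C0 * C1 powr (q / p) * (D + 1) powr (q / p) * R powr (n + \<sigma>)"
    if R: "0 < R" and \<eta>: "0 < \<eta>" and D: "0 \<le> D"
      "\<And>\<rho>. 0 < \<rho> \<Longrightarrow> (LINT y:{y \<in> ball x (2 * R) - ball x R. \<rho> \<le> ?d y}|lborel. ?d y powr \<beta>) \<le> D * R powr (n + \<beta>)"
    for x R D \<eta>
  proof -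
    define \<epsilon> where "\<epsilon> = min (\<eta> / 2) (R powr \<tau>)"
    have \<epsilon>: "0 < \<epsilon>" using R \<eta> by (simp add: \<epsilon>_def)
    obtain P where P: "finite P" "\<forall>(c, r)\<in>P. c \<in> E \<and> 0 < r \<and> r < \<epsilon>"
      "E \<inter> cball x (2 * R) \<subseteq> (\<Union>(c, r)\<in>P. ball c r)" "(\<Sum>(c, r)\<in>P. r powr \<tau>) \<le> \<epsilon>"
      "\<forall>(c, r)\<in>P. \<forall>y\<in>ball c (2 * r) - (\<Union>(c, r)\<in>P. ball c r) - E. ?d y powr \<beta> \<le> K * r powr \<beta>"
      using K(2)[unfolded fine_covers_def, THEN spec, THEN mp, OF \<epsilon>, THEN spec, THEN spec, of x "2 * R"]
      by (elim exE conjE) (rule that)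
    have centre: "c \<in> E \<and> 0 < r \<and> r < \<epsilon>" if "(c, r) \<in> P" for c r
      using bspec[OF P(2) that] by simp
    have weight: "?d y powr \<beta> \<le> K * r powr \<beta>"
      if "(c, r) \<in> P" "y \<in> ball c (2 * r)" "y \<notin> (\<Union>(c, r)\<in>P. ball c r)" "y \<notin> E" for c r y
      using bspec[OF P(5) that(1)] that(2-) by simp
    define U where "U = (\<Union>(c, r)\<in>P. ball c r)"
    have U: "U = (\<Union>b\<in>P. ball (fst b) (snd b))" by (auto simp: U_def)
    have [simp]: "open U" by (auto simp: U_def)
    define \<psi> where "\<psi> = cutoff m P fst snd"
    define f where "f = (\<lambda>y. bump x R y * \<psi> y)"
    define T where "T = cball x (2 * R) - U"
    have P0: "0 < snd b" if "b \<in> P" for b using centre[of "fst b" "snd b"] that by simp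
    have \<psi>0: "\<psi> y = 0" if "y \<in> U" for y
      using that cutoff_eq_0[OF P(1), of _ snd y fst m] P0 by (auto simp: \<psi>_def U)
    have T: "compact T" "T \<inter> E = {}"
      using P(3) by (auto simp: T_def U_def intro!: compact_diff)
    have supp: "{y. f y \<noteq> 0} \<subseteq> T"
      using bump_eq_0[OF R, of x] \<psi>0 by (force simp: f_def T_def)
    then have cl: "closure {y. f y \<noteq> 0} \<subseteq> T"
      using T(1) by (simp add: closure_minimal compact_imp_closed)
    have "bounded {y. f y \<noteq> 0}"
      using bounded_subset[OF compact_imp_bounded[OF T(1)] supp] .
    then have "compact (closure {y. f y \<noteq> 0})" by simp
    moreover have "smooth f"
      unfolding f_def \<psi>_def by (intro smooth_mult smooth_bump smooth_cutoff)
    ultimately have f: "f \<in> test_functions (- E)"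
      using T cl unfolding test_functions_def by blast
    \<comment> \<open>On the support of the product, \<open>E\<close> stays at a positive distance; this is the truncation level
      at which the hypothesis on the weight in the annulus is used.\<close>
    obtain \<rho> where \<rho>': "0 < \<rho>" "\<forall>y\<in>T. \<forall>z\<in>E. \<rho> \<le> dist y z"
      using separate_compact_closed[OF T(1) E(1) T(2)] by blast
    then have \<rho>: "0 < \<rho>" "\<rho> \<le> ?d y" if "y \<in> T" for y
      using that by (auto intro: infdist_geI[OF E(2)])
    define A' where "A' = {y \<in> ball x (2 * R) - ball x R. \<rho> \<le> ?d y}"
    define B where "B y = 2 powr p * (L2 * (\<Sum>(c, r)\<in>P. r powr - p * (K * r powr \<beta>) * indicator (ball c (2 * r)) y)
      + (L1 / R) powr p * (indicator A' y * ?d y powr \<beta>))" for y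
    have int': "integrable lborel (\<lambda>y. indicator A' y * ?d y powr \<beta>)"
      using set_integrable_infdist_powr[of "ball x (2 * R) - ball x R" \<rho> E \<beta>] \<rho>'(1)
      by (simp add: set_integrable_def A'_def bounded_diff)
    have int: "integrable lborel (\<lambda>y. r powr - p * (K * r powr \<beta>) * indicator (ball c (2 * r)) y)"
      for c :: "real ^ 'n" and r
    proof -
      have "emeasure lborel (ball c (2 * r)) < \<infinity>" by (rule emeasure_lborel_ball_finite)
      then show ?thesis by (intro integrable_mult_right integrable_real_indicator) simp_all
    qed
    have "(LINT y:{y \<in> ball x R. \<eta> \<le> ?d y}|lborel. ?d y powr \<sigma>) \<le> C0 * (LINT y|lborel. B y) powr (q / p)"
    proof (rule C0(2)[OF f])
      show "{y \<in> ball x R. \<eta> \<le> ?d y} \<subseteq> - E" using \<eta> by (auto simp: not_le)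
      show "1 \<le> \<bar>f y\<bar>" if y: "y \<in> {y \<in> ball x R. \<eta> \<le> ?d y}" for y
      proof -
        have "y \<notin> ball c (2 * r)" if cr: "(c, r) \<in> P" for c r
          using infdist_le[of c E y] centre[OF cr] y by (auto simp: \<epsilon>_def dist_commute)
        then have "\<psi> y = 1"
          unfolding \<psi>_def using P0 m by (intro cutoff_eq_1) auto
        moreover have "bump x R y = 1" using y R by (intro bump_eq_1) auto
        ultimately show ?thesis by (simp add: f_def)
      qed
      show "integrable lborel B"
        unfolding B_def[abs_def] case_prod_beta
        by (intro integrable_mult_right Bochner_Integration.integrable_add
            Bochner_Integration.integrable_sum int int')
      show "0 \<le> B y" for y
        unfolding B_def case_prod_beta using L1(1) L2(1) K
        by (intro mult_nonneg_nonneg add_nonneg_nonneg sum_nonneg) auto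
      show "norm (gradient f y) powr p * ?d y powr \<beta> \<le> B y" if y: "y \<in> - E" for y
      proof -
        have "gradient f y = bump x R y *\<^sub>R gradient \<psi> y + \<psi> y *\<^sub>R gradient (bump x R) y"
          unfolding f_def \<psi>_def
          by (intro gradient_eqI GDERIV_mult smooth_GDERIV smooth_bump smooth_cutoff)
        then have "norm (gradient f y) \<le> norm (bump x R y *\<^sub>R gradient \<psi> y) + norm (\<psi> y *\<^sub>R gradient (bump x R) y)"
          using norm_triangle_ineq by metis
        also have "norm (bump x R y *\<^sub>R gradient \<psi> y) \<le> norm (gradient \<psi> y)"
          using bump_bounds[of x R y] by (simp add: mult_left_le_one_le)
        also have "norm (\<psi> y *\<^sub>R gradient (bump x R) y) \<le> L1 / R * indicator A' y"
        proof (cases "y \<in> U")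
          case False
          have "norm (\<psi> y *\<^sub>R gradient (bump x R) y) \<le> norm (gradient (bump x R) y)"
            using cutoff_bounds[of m P fst snd y] by (simp add: \<psi>_def mult_left_le_one_le)
          also have "\<dots> \<le> L1 / R * indicator (ball x (2 * R) - ball x R) y" by (rule L1(2)[OF R])
          also have "\<dots> = L1 / R * indicator A' y"
            using \<rho>(2)[of y] False by (auto simp: indicator_def A'_def T_def)
          finally show ?thesis .
        qed (use \<psi>0 L1(1) R in simp)
        finally have "norm (gradient f y) powr p \<le> (norm (gradient \<psi> y) + L1 / R * indicator A' y) powr p"
          using p by (intro powr_mono2) auto
        also have "\<dots> \<le> 2 powr p * (norm (gradient \<psi> y) powr p + (L1 / R * indicator A' y) powr p)"
          using p L1(1) R by (intro powr_sum_le) auto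
        also have "(L1 / R * indicator A' y) powr p = (L1 / R) powr p * indicator A' y"
          using p by (auto simp: indicator_def)
        also have "norm (gradient \<psi> y) powr p \<le> L2 * (\<Sum>(c, r)\<in>P. r powr - p * indicator (ball c (2 * r) - U) y)"
          using L2(2)[rule_format, OF P(1), of snd fst y] P0 by (simp add: \<psi>_def U case_prod_beta)
        finally have "norm (gradient f y) powr p * ?d y powr \<beta> \<le>
          2 powr p * (L2 * (\<Sum>(c, r)\<in>P. r powr - p * indicator (ball c (2 * r) - U) y)
            + (L1 / R) powr p * indicator A' y) * ?d y powr \<beta>"
          by (intro mult_right_mono) auto
        also have "\<dots> = 2 powr p * (L2 * (\<Sum>(c, r)\<in>P. r powr - p * (?d y powr \<beta> * indicator (ball c (2 * r) - U) y))
            + (L1 / R) powr p * (indicator A' y * ?d y powr \<beta>))"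
          by (simp add: algebra_simps sum_distrib_left sum_distrib_right case_prod_beta)
        also have "\<dots> \<le> B y"
        proof -
          have "?d y powr \<beta> * indicator (ball c (2 * r) - U) y \<le> K * r powr \<beta> * indicator (ball c (2 * r)) y"
            if "(c, r) \<in> P" for c r
            using weight[OF that, of y] y K by (simp add: indicator_def U_def)
          then show ?thesis
            unfolding B_def using L2(1)
            by (intro mult_left_mono add_right_mono sum_mono)
              (auto simp: mult.assoc intro!: mult_left_mono)
        qed
        finally show ?thesis .
      qed
    qed
    also have "(LINT y|lborel. B y) = 2 powr p * (L2 * (\<Sum>(c, r)\<in>P. r powr - p * (K * r powr \<beta>) * measure lborel (ball c (2 * r)))
        + (L1 / R) powr p * (LINT y:A'|lborel. ?d y powr \<beta>))"
    proof -
      have "(LINT y|lborel. (\<Sum>(c, r)\<in>P. r powr - p * (K * r powr \<beta>) * indicator (ball c (2 * r)) y))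
        = (\<Sum>(c, r)\<in>P. r powr - p * (K * r powr \<beta>) * measure lborel (ball c (2 * r)))"
        unfolding case_prod_beta by (subst Bochner_Integration.integral_sum) (use int in auto)
      moreover have "integrable lborel (\<lambda>y. \<Sum>(c, r)\<in>P. r powr - p * (K * r powr \<beta>) * indicator (ball c (2 * r)) y)"
        unfolding case_prod_beta by (intro Bochner_Integration.integrable_sum int)
      ultimately show ?thesis
        unfolding B_def using int' by (simp add: set_lebesgue_integral_def)
    qed
    also have "(\<Sum>(c, r)\<in>P. r powr - p * (K * r powr \<beta>) * measure lborel (ball c (2 * r)))
        = (\<Sum>(c, r)\<in>P. K * \<omega> * 2 powr n * r powr \<tau>)"
    proof (rule sum.cong[OF refl], clarify)
      fix c r assume "(c, r) \<in> P"
      then have r: "0 < r" using centre by blast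
      then have "r powr - p * r powr \<beta> * r powr n = r powr \<tau>"
        by (simp add: \<tau>_def algebra_simps flip: powr_add)
      then show "r powr - p * (K * r powr \<beta>) * measure lborel (ball c (2 * r)) = K * \<omega> * 2 powr n * r powr \<tau>"
        using r by (simp add: vol powr_mult algebra_simps)
    qed
    also have "\<dots> = K * \<omega> * 2 powr n * (\<Sum>(c, r)\<in>P. r powr \<tau>)"
      by (simp add: sum_distrib_left case_prod_beta)
    also have "C0 * (2 powr p * (L2 * (K * \<omega> * 2 powr n * (\<Sum>(c, r)\<in>P. r powr \<tau>)) +
        (L1 / R) powr p * (LINT y:A'|lborel. ?d y powr \<beta>))) powr (q / p)
      \<le> C0 * (2 powr p * (L2 * (K * \<omega> * 2 powr n * ((D + 1) * R powr \<tau>)) +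
        (L1 / R) powr p * ((D + 1) * R powr (n + \<beta>)))) powr (q / p)"
    proof -
      have "(\<Sum>(c, r)\<in>P. r powr \<tau>) \<le> (D + 1) * R powr \<tau>"
      proof -
        have "(\<Sum>(c, r)\<in>P. r powr \<tau>) \<le> 1 * R powr \<tau>" using P(4) by (simp add: \<epsilon>_def)
        also have "\<dots> \<le> (D + 1) * R powr \<tau>" using D(1) by (intro mult_right_mono) auto
        finally show ?thesis .
      qed
      moreover have "(LINT y:A'|lborel. ?d y powr \<beta>) \<le> (D + 1) * R powr (n + \<beta>)"
      proof -
        have "(LINT y:A'|lborel. ?d y powr \<beta>) \<le> D * R powr (n + \<beta>)"
          using D(2)[OF \<rho>'(1)] by (simp add: A'_def)
        also have "\<dots> \<le> (D + 1) * R powr (n + \<beta>)" by (intro mult_right_mono) auto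
        finally show ?thesis .
      qed
      moreover have "0 \<le> (LINT y:A'|lborel. ?d y powr \<beta>)"
        unfolding set_lebesgue_integral_def by (rule integral_nonneg_AE) auto
      moreover have "0 \<le> (\<Sum>(c, r)\<in>P. r powr \<tau>)" by (auto intro: sum_nonneg)
      ultimately show ?thesis
        using C0(1) L2(1) K(1) \<omega> p
        by (intro mult_left_mono powr_mono2 add_mono mult_nonneg_nonneg add_nonneg_nonneg) auto
    qed
    also have "2 powr p * (L2 * (K * \<omega> * 2 powr n * ((D + 1) * R powr \<tau>)) +
        (L1 / R) powr p * ((D + 1) * R powr (n + \<beta>))) = C1 * ((D + 1) * R powr \<tau>)"
    proof -
      have "(L1 / R) powr p * R powr (n + \<beta>) = L1 powr p * R powr \<tau>"
        using R L1(1) by (simp add: powr_divide \<tau>_def powr_diff powr_add)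
      then show ?thesis by (simp add: C1_def algebra_simps)
    qed
    also have "C0 * (C1 * ((D + 1) * R powr \<tau>)) powr (q / p)
      = C0 * C1 powr (q / p) * (D + 1) powr (q / p) * R powr (n + \<sigma>)"
      using C1 D(1) by (simp add: powr_mult powr_powr \<sigma>_def mult_ac)
    finally show ?thesis .
  qed
  have "0 < C0 * C1 powr (q / p)" using C0 C1 by simp
  then show ?thesis by (rule that[OF _ main])
qed

section \<open>From integrability of the distance to the Assouad dimension\<close>

lemma content_ball_scale:
  fixes c :: "'a::euclidean_space"
  assumes "0 < r"
  shows "measure lborel (ball c r) = measure lborel (ball (0::'a) 1) * r powr DIM('a)"
  using assms content_ball_conv_unit_ball[of r c] by (simp add: powr_realpow)

lemma fmeasurable_near:
  fixes x :: "'a::euclidean_space"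
  shows "{y \<in> ball x R. infdist y E < r} \<in> fmeasurable lborel"
proof (rule fmeasurableI)
  have "open {y. infdist y E < r}" by (intro open_Collect_less continuous_intros)
  then have "open (ball x R \<inter> {y. infdist y E < r})" by blast
  moreover have "ball x R \<inter> {y. infdist y E < r} = {y \<in> ball x R. infdist y E < r}" by auto
  ultimately show "{y \<in> ball x R. infdist y E < r} \<in> sets lborel" by simp
  show "emeasure lborel {y \<in> ball x R. infdist y E < r} < \<infinity>"
    by (rule emeasure_bounded_finite) (auto intro: bounded_subset[OF bounded_ball])
qed

text \<open>The balls of radius \<open>r / 2\<close> about a maximal \<open>r\<close>-separated subset are disjoint and lie
  close to \<open>E\<close>, so the volume of a neighbourhood controls the size of the subset.\<close>

lemma cover_by_volume:
  fixes E :: "'a::euclidean_space set"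
  assumes r: "0 < r" "r \<le> R"
  obtains S where "finite S" "S \<subseteq> E" "E \<inter> ball x R \<subseteq> (\<Union>s\<in>S. ball s r)"
    "card S * measure lborel (ball (0::'a) 1) * (r / 2) powr DIM('a)
      \<le> measure lborel {y \<in> ball x (2 * R). infdist y E < r}"
proof -
  define \<omega> where "\<omega> = measure lborel (ball (0::'a) 1)"
  define V where "V = measure lborel {y \<in> ball x (2 * R). infdist y E < r}"
  have \<omega>: "0 < \<omega>" unfolding \<omega>_def by (rule content_ball_pos) simp
  define sep where "sep S \<longleftrightarrow> finite S \<and> S \<subseteq> E \<inter> ball x R \<and> (\<forall>s\<in>S. \<forall>t\<in>S. s \<noteq> t \<longrightarrow> r \<le> dist s t)" for S
  have vol: "card S * \<omega> * (r / 2) powr DIM('a) \<le> V" if S: "sep S" for S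
  proof -
    have "disjoint_family_on (\<lambda>s. ball s (r / 2)) S"
      unfolding disjoint_family_on_def
    proof (intro ballI impI)
      fix s t assume "s \<in> S" "t \<in> S" "s \<noteq> t"
      then have "r \<le> dist s t" using S by (auto simp: sep_def)
      then show "ball s (r / 2) \<inter> ball t (r / 2) = {}"
        by (intro disjoint_ballI) simp
    qed
    then have "measure lborel (\<Union>s\<in>S. ball s (r / 2)) = (\<Sum>s\<in>S. measure lborel (ball s (r / 2)))"
      using S emeasure_lborel_ball_finite
      by (intro measure_finite_Union) (auto simp: sep_def less_top[symmetric])
    also have "\<dots> = card S * \<omega> * (r / 2) powr DIM('a)"
      using content_ball_scale[where 'a='a, of "r / 2"] r by (simp add: \<omega>_def)
    finally have "card S * \<omega> * (r / 2) powr DIM('a) = measure lborel (\<Union>s\<in>S. ball s (r / 2))" ..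
    also have "\<dots> \<le> V"
      unfolding V_def
    proof (rule measure_mono_fmeasurable[OF _ _ fmeasurable_near])
      show "(\<Union>s\<in>S. ball s (r / 2)) \<subseteq> {y \<in> ball x (2 * R). infdist y E < r}"
      proof
        fix y assume "y \<in> (\<Union>s\<in>S. ball s (r / 2))"
        then obtain s where s: "s \<in> E" "dist x s < R" "dist s y < r / 2"
          using S by (auto simp: sep_def subset_iff)
        then show "y \<in> {y \<in> ball x (2 * R). infdist y E < r}"
          using infdist_le[OF s(1), of y] dist_triangle[of x y s] r by (auto simp: dist_commute)
      qed
      show "(\<Union>s\<in>S. ball s (r / 2)) \<in> sets lborel" using S by (auto simp: sep_def)
    qed
    finally show ?thesis .
  qed
  have bound: "card S < Suc (nat \<lceil>V / (\<omega> * (r / 2) powr DIM('a))\<rceil>)" if "sep S" for S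
  proof -
    have "real (card S) \<le> V / (\<omega> * (r / 2) powr DIM('a))"
      using vol[OF that] \<omega> r by (simp add: pos_le_divide_eq mult.assoc)
    then show ?thesis by linarith
  qed
  have "sep {}" by (simp add: sep_def)
  then have "\<exists>S. sep S \<and> (\<forall>T. sep T \<longrightarrow> card T \<le> card S)"
    by (rule ex_has_greatest_nat) (intro allI impI, erule bound)
  then obtain S where S: "sep S" "\<forall>T. sep T \<longrightarrow> card T \<le> card S"
    by (elim exE conjE)
  have "E \<inter> ball x R \<subseteq> (\<Union>s\<in>S. ball s r)"
  proof (rule ccontr)
    assume "\<not> ?thesis"
    then obtain y where y: "y \<in> E \<inter> ball x R" "y \<notin> (\<Union>s\<in>S. ball s r)" by blast
    then have far: "r \<le> dist s y" if "s \<in> S" for s using that by (simp add: not_less)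
    then have "y \<notin> S" using far[of y] r by auto
    moreover have "sep (insert y S)"
      using S(1) y far by (auto simp: sep_def dist_commute)
    ultimately show False
      using spec[OF S(2), of "insert y S"] S(1) by (simp add: sep_def)
  qed
  moreover have "finite S" "S \<subseteq> E" using S(1) by (auto simp: sep_def)
  ultimately show ?thesis
    using vol[OF S(1)] unfolding \<omega>_def V_def by - (rule that)
qed

text \<open>Moving the centres of a cover into the covered set costs a factor \<open>2\<close> in the radius.\<close>

lemma covering_number_le_card:
  assumes "finite S" "A \<subseteq> (\<Union>s\<in>S. ball s (r / 2))"
  shows "covering_number A r \<le> card S"
proof -
  define S' where "S' = {s \<in> S. A \<inter> ball s (r / 2) \<noteq> {}}"
  define f where "f s = (SOME y. y \<in> A \<inter> ball s (r / 2))" for s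
  have f: "f s \<in> A \<inter> ball s (r / 2)" if "s \<in> S'" for s
  proof -
    have "\<exists>y. y \<in> A \<inter> ball s (r / 2)" using that by (auto simp: S'_def)
    then show ?thesis unfolding f_def by (rule someI_ex)
  qed
  have "A \<subseteq> (\<Union>x\<in>f ` S'. ball x r)"
  proof
    fix y assume y: "y \<in> A"
    then obtain s where "s \<in> S" "y \<in> ball s (r / 2)" using assms by blast
    with y have s: "s \<in> S'" "y \<in> ball s (r / 2)" unfolding S'_def by blast+
    then have "dist (f s) y < r"
      using f[OF s(1)] dist_triangle_half_l[of "f s" s r y] by (auto simp: dist_commute)
    then show "y \<in> (\<Union>x\<in>f ` S'. ball x r)" using s by auto
  qed
  moreover have "f ` S' \<subseteq> A" "finite (f ` S')" using f assms by (auto simp: S'_def)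
  ultimately have "covering_number A r \<le> card (f ` S')"
    unfolding covering_number_def by (intro Least_le) blast
  also have "\<dots> \<le> card S'" using assms by (intro card_image_le) (auto simp: S'_def)
  also have "\<dots> \<le> card S" using assms by (intro card_mono) (auto simp: S'_def)
  finally show ?thesis .
qed

lemma assouad_dim_le:
  fixes E :: "'a::metric_space set"
  assumes C: "0 < C" and t: "0 \<le> t"
    and cover: "\<And>x r R. x \<in> E \<Longrightarrow> 0 < r \<Longrightarrow> r \<le> R \<Longrightarrow>
      \<exists>S. finite S \<and> real (card S) \<le> C * (R / r) powr t \<and> E \<inter> ball x R \<subseteq> (\<Union>s\<in>S. ball s r)"
  shows "assouad_dim E \<le> ereal t"
proof -
  have main: "real (covering_number (E \<inter> ball x R) r) \<le> C * 2 powr t * (r / R) powr - t"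
    if "x \<in> E" "0 < r" "r < R" for x r R
  proof -
    have "0 < r / 2" "r / 2 \<le> R" using that by auto
    from cover[OF that(1) this]
    obtain S where S: "finite S" "real (card S) \<le> C * (R / (r / 2)) powr t"
        "E \<inter> ball x R \<subseteq> (\<Union>s\<in>S. ball s (r / 2))"
      by blast
    have "real (covering_number (E \<inter> ball x R) r) \<le> C * (R / (r / 2)) powr t"
      using covering_number_le_card[OF S(1,3)] S(2) by linarith
    also have "(R / (r / 2)) powr t = 2 powr t * (r / R) powr - t"
      using that by (simp add: powr_minus powr_divide powr_mult field_simps)
    finally show ?thesis by (simp add: mult.assoc)
  qed
  have "0 < C * 2 powr t" using C by simp
  then have "\<exists>C>0. \<forall>x\<in>E. \<forall>r R. 0 < r \<and> r < R \<and> ereal R < ediameter E \<longrightarrow>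
      real (covering_number (E \<inter> ball x R) r) \<le> C * (r / R) powr (- t)"
    using main by (intro exI[of _ "C * 2 powr t"]) simp
  with t show ?thesis
    unfolding assouad_dim_def by - (rule Inf_lower, rule CollectI, rule exI[of _ t], simp)
qed

lemma cover_doubling:
  fixes E :: "'a::euclidean_space set"
  assumes r: "0 < r" "r \<le> R"
  shows "\<exists>S. finite S \<and> S \<subseteq> E \<and> real (card S) \<le> 4 powr DIM('a) * (R / r) powr DIM('a) \<and>
    E \<inter> ball x R \<subseteq> (\<Union>s\<in>S. ball s r)"
proof -
  define \<omega> where "\<omega> = measure lborel (ball (0::'a) 1)"
  have \<omega>: "0 < \<omega>" unfolding \<omega>_def by (rule content_ball_pos) simp
  obtain S where S: "finite S" "S \<subseteq> E" "E \<inter> ball x R \<subseteq> (\<Union>s\<in>S. ball s r)"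
    "card S * \<omega> * (r / 2) powr DIM('a) \<le> measure lborel {y \<in> ball x (2 * R). infdist y E < r}"
    by (rule cover_by_volume[OF r, of E x, folded \<omega>_def]) (rule that)
  have "ball x (2 * R) \<in> fmeasurable lborel"
    by (rule fmeasurableI) (auto simp: emeasure_lborel_ball_finite[unfolded infinity_ennreal_def])
  then have "measure lborel {y \<in> ball x (2 * R). infdist y E < r} \<le> measure lborel (ball x (2 * R))"
    using fmeasurableD[OF fmeasurable_near[of x "2 * R" E r]] by (intro measure_mono_fmeasurable) auto
  also have "\<dots> = \<omega> * (2 * R) powr DIM('a)"
    using content_ball_scale[of "2 * R" x] r by (simp add: \<omega>_def)
  finally have "\<omega> * (card S * (r / 2) powr DIM('a)) \<le> \<omega> * (2 * R) powr DIM('a)"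
    using S(4) by (simp only: mult_ac)
  then have "card S * (r / 2) powr DIM('a) \<le> (2 * R) powr DIM('a)"
    using mult_le_cancel_left_pos[OF \<omega>] by blast
  then have "card S \<le> (2 * R) powr DIM('a) / (r / 2) powr DIM('a)"
    using r by (subst pos_le_divide_eq) auto
  also have "\<dots> = (2 * R / (r / 2)) powr DIM('a)" by (rule powr_divide[symmetric])
  also have "2 * R / (r / 2) = 4 * (R / r)" by simp
  also have "(4 * (R / r)) powr DIM('a) = 4 powr DIM('a) * (R / r) powr DIM('a)" by (rule powr_mult)
  finally show ?thesis using S by blast
qed

lemma assouad_dim_le_DIM:
  fixes E :: "'a::euclidean_space set"
  shows "assouad_dim E \<le> ereal (DIM('a))"
proof (rule assouad_dim_le)
  show "(0::real) < 4 powr DIM('a)" by simp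
  fix x :: 'a and r R :: real assume "0 < r" "r \<le> R"
  from cover_doubling[OF this, of E x]
  show "\<exists>S. finite S \<and> real (card S) \<le> 4 powr DIM('a) * (R / r) powr DIM('a) \<and>
      E \<inter> ball x R \<subseteq> (\<Union>s\<in>S. ball s r)"
    by (elim exE conjE) (intro exI conjI)
qed simp

text \<open>If every ball admits one scale, at most \<open>K\<close> dyadic steps down, at which it needs only half
  of the \<open>2 ^ (k s)\<close> balls that dimension \<open>s\<close> would allow, then iterating over these scales gains a
  factor \<open>1 / 2\<close> at least once in \<open>K\<close> steps, that is, \<open>1 / K\<close> in the exponent.\<close>

lemma assouad_dim_le_iterate:
  fixes E :: "'a::euclidean_space set"
  assumes K: "0 < K" "1 / real K \<le> s"
    and half: "\<And>x R. x \<in> E \<Longrightarrow> 0 < R \<Longrightarrow> \<exists>k S. 1 \<le> k \<and> k \<le> K \<and> finite S \<and> S \<subseteq> E \<and>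
      real (card S) \<le> 2 powr (k * s) / 2 \<and> E \<inter> ball x R \<subseteq> (\<Union>y\<in>S. ball y (R / 2 ^ k))"
  shows "assouad_dim E \<le> ereal (s - 1 / K)"
proof -
  let ?t = "s - 1 / K"
  have t: "0 \<le> ?t" using K by simp
  define C' where "C' = 4 powr DIM('a) * (2 ^ K) powr DIM('a)"
  have C': "0 < C'" by (simp add: C'_def)
  have iter: "\<exists>S. finite S \<and> real (card S) \<le> C' * (R / r) powr ?t \<and> E \<inter> ball x R \<subseteq> (\<Union>s\<in>S. ball s r)"
    if "x \<in> E" "0 < r" "r \<le> R" "R < 2 ^ j * r" for x r R j
    using that
  proof (induction j arbitrary: x R)
    case (Suc j)
    have r: "0 < r" "0 < R" using Suc.prems by auto
    show ?case
    proof (cases "R \<le> 2 ^ K * r")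
      case True
      obtain S where S: "finite S" "real (card S) \<le> 4 powr DIM('a) * (R / r) powr DIM('a)"
          "E \<inter> ball x R \<subseteq> (\<Union>s\<in>S. ball s r)"
        using cover_doubling[OF Suc.prems(2,3), of E x] by blast
      have "4 powr DIM('a) * (R / r) powr DIM('a) \<le> C'"
        unfolding C'_def using True r
        by (intro mult_left_mono powr_mono2) (auto simp: divide_le_eq)
      also have "\<dots> \<le> C' * (R / r) powr ?t"
        using C' ge_one_powr_ge_zero[of "R / r" ?t] t Suc.prems by simp
      finally show ?thesis using S by force
    next
      case False
      obtain k S where kS: "1 \<le> k" "k \<le> K" "finite S" "S \<subseteq> E"
          "real (card S) \<le> 2 powr (k * s) / 2" "E \<inter> ball x R \<subseteq> (\<Union>y\<in>S. ball y (R / 2 ^ k))"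
        using half[OF Suc.prems(1) r(2)] by blast
      let ?R = "R / 2 ^ k"
      have "2 ^ k * r \<le> 2 ^ K * r" using kS r by (intro mult_right_mono power_increasing) auto
      then have 1: "r \<le> ?R" using False by (simp add: pos_le_divide_eq mult.commute)
      have "2 * (2 ^ j * r) \<le> 2 ^ k * (2 ^ j * r)"
        using kS r power_increasing[of 1 k "2::real"] by (intro mult_right_mono) auto
      then have 2: "?R < 2 ^ j * r"
        using Suc.prems(4) by (simp add: pos_divide_less_eq mult_ac)
      have "\<forall>y\<in>S. \<exists>T. finite T \<and> real (card T) \<le> C' * (?R / r) powr ?t \<and> E \<inter> ball y ?R \<subseteq> (\<Union>s\<in>T. ball s r)"
        using Suc.IH[OF _ r(1) 1 2] kS(4) by blast
      then obtain T where T: "\<And>y. y \<in> S \<Longrightarrow> finite (T y)"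
          "\<And>y. y \<in> S \<Longrightarrow> real (card (T y)) \<le> C' * (?R / r) powr ?t"
          "\<And>y. y \<in> S \<Longrightarrow> E \<inter> ball y ?R \<subseteq> (\<Union>s\<in>T y. ball s r)"
        by metis
      have "E \<inter> ball x R \<subseteq> (\<Union>s\<in>(\<Union>y\<in>S. T y). ball s r)"
      proof
        fix z assume z: "z \<in> E \<inter> ball x R"
        then obtain y where y: "y \<in> S" "z \<in> ball y ?R" using kS(6) by blast
        then have "z \<in> (\<Union>s\<in>T y. ball s r)" using T(3) z by blast
        then show "z \<in> (\<Union>s\<in>(\<Union>y\<in>S. T y). ball s r)" using y(1) by blast
      qed
      moreover have "finite (\<Union>y\<in>S. T y)" using kS(3) T(1) by blast
      moreover have "real (card (\<Union>y\<in>S. T y)) \<le> C' * (R / r) powr ?t"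
      proof -
        have "real (card (\<Union>y\<in>S. T y)) \<le> (\<Sum>y\<in>S. real (card (T y)))"
          using card_UN_le[OF kS(3), of T] by (simp flip: of_nat_sum)
        also have "\<dots> \<le> real (card S) * (C' * (?R / r) powr ?t)"
          using T(2) by (rule sum_bounded_above)
        also have "\<dots> \<le> 2 powr (k * s) / 2 * (C' * (?R / r) powr ?t)"
          using kS(5) C' by (intro mult_right_mono) auto
        also have "(?R / r) powr ?t = (R / r) powr ?t * 2 powr (- (k * ?t))"
        proof -
          have "?R / r = (R / r) * 2 powr (- real k)"
            by (simp add: powr_minus powr_realpow field_simps)
          then have "(?R / r) powr ?t = (R / r) powr ?t * (2 powr (- real k)) powr ?t"
            by (simp only: powr_mult)
          then show ?thesis by (simp add: powr_powr)
        qed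
        also have "2 powr (k * s) / 2 * (C' * ((R / r) powr ?t * 2 powr (- (k * ?t))))
            = 2 powr (k * s + - (k * ?t) + - 1) * (C' * (R / r) powr ?t)"
          unfolding powr_add by (simp add: powr_minus)
        also have "\<dots> \<le> 2 powr 0 * (C' * (R / r) powr ?t)"
          using kS K C' by (intro mult_right_mono powr_mono) (auto simp: field_simps)
        finally show ?thesis by simp
      qed
      ultimately show ?thesis by blast
    qed
  qed simp
  show ?thesis
  proof (rule assouad_dim_le[OF C' t])
    fix x r R assume x: "x \<in> E" "0 < r" "r \<le> (R::real)"
    obtain j where "R / r < 2 ^ j" using real_arch_pow[of 2 "R / r"] by auto
    then have "R < 2 ^ j * r" using x by (simp add: pos_divide_less_eq)
    from iter[OF x this] show "\<exists>S. finite S \<and> real (card S) \<le> C' * (R / r) powr ?t \<and>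
        E \<inter> ball x R \<subseteq> (\<Union>s\<in>S. ball s r)" .
  qed
qed

text \<open>The scales $R / 2^k$ above \<open>d\<close> form a geometric progression, so the sum is governed by the smallest
  of them, which exceeds \<open>d\<close>.\<close>

lemma geometric_layers:
  fixes a d R :: real
  assumes a: "0 < a" and d: "0 < d" and R: "0 < R"
  shows "(\<Sum>k=1..K. of_bool (d < R / 2 ^ k) * (R / 2 ^ k) powr - a) \<le> d powr - a / (1 - 2 powr - a)"
proof -
  define A where "A = 1 / (1 - 2 powr - a)"
  have "2 powr - a < (1::real)" using a powr_less_mono[of "- a" 0 2] by simp
  then have "0 < A" "A * (1 - 2 powr - a) = 1" by (auto simp: A_def)
  then have A: "0 < A" "A * 2 powr - a + 1 = A" by (auto simp: right_diff_distrib)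
  have full: "(\<Sum>k=1..K. (R / 2 ^ k) powr - a) \<le> A * (R / 2 ^ K) powr - a" for K
  proof (induction K)
    case (Suc K)
    have "R / 2 ^ K = 2 * (R / 2 ^ Suc K)" by simp
    then have "(R / 2 ^ K) powr - a = 2 powr - a * (R / 2 ^ Suc K) powr - a"
      by (simp only: powr_mult)
    then have "(\<Sum>k=1..Suc K. (R / 2 ^ k) powr - a) \<le> (A * 2 powr - a + 1) * (R / 2 ^ Suc K) powr - a"
      using Suc by (simp add: distrib_right mult.assoc)
    then show ?case by (simp only: A)
  qed (use A in simp)
  have "(\<Sum>k=1..K. of_bool (d < R / 2 ^ k) * (R / 2 ^ k) powr - a) \<le> A * d powr - a"
  proof (induction K)
    case (Suc K)
    show ?case
    proof (cases "d < R / 2 ^ Suc K")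
      case True
      have "(\<Sum>k=1..Suc K. of_bool (d < R / 2 ^ k) * (R / 2 ^ k) powr - a) \<le> (\<Sum>k=1..Suc K. (R / 2 ^ k) powr - a)"
        by (intro sum_mono) auto
      also have "\<dots> \<le> A * (R / 2 ^ Suc K) powr - a" by (rule full)
      also have "\<dots> \<le> A * d powr - a"
        using A True a d by (intro mult_left_mono powr_mono2') auto
      finally show ?thesis .
    qed (use Suc in simp)
  qed (use A in simp)
  then show ?thesis by (simp add: A_def)
qed

text \<open>Integrate the bound of \<open>geometric_layers\<close> over $\delta \ge \eta$ and let \<open>\<eta>\<close> tend to \<open>0\<close>.  As
  \<open>E\<close> is a null set, the truncated layers exhaust the full ones up to measure zero.\<close>

lemma volume_layers:
  fixes E :: "'a::euclidean_space set" and C s :: real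
  assumes E: "closed E" "E \<in> null_sets lborel" "E \<noteq> {}" and s: "s < DIM('a)" and R: "0 < R"
    and int: "\<And>\<eta>. 0 < \<eta> \<Longrightarrow> (LINT y:{y \<in> ball x (2 * R). \<eta> \<le> infdist y E}|lborel.
      infdist y E powr (s - DIM('a))) \<le> I"
  shows "(\<Sum>k=1..K. (R / 2 ^ k) powr (s - DIM('a)) * measure lborel {y \<in> ball x (2 * R). infdist y E < R / 2 ^ k})
    \<le> I / (1 - 2 powr (s - DIM('a)))"
proof -
  define a where "a = DIM('a) - s"
  have a: "0 < a" "s - DIM('a) = - a" using s by (auto simp: a_def)
  define B where "B k = {y \<in> ball x (2 * R). infdist y E < R / 2 ^ k}" for k :: nat
  define L where "L \<eta> = {y. \<eta> \<le> infdist y E}" for \<eta>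
  have L: "L \<eta> \<in> sets borel" for \<eta> unfolding L_def by (intro borel_closed closed_infdist_ge)
  have B: "B k \<in> fmeasurable lborel" for k unfolding B_def by (rule fmeasurable_near)
  have BL: "B k \<inter> L \<eta> \<in> fmeasurable lborel" for k \<eta>
    using L[of \<eta>] by (intro fmeasurable_Int_fmeasurable B) simp
  have trunc: "(\<Sum>k=1..K. (R / 2 ^ k) powr - a * measure lborel (B k \<inter> L \<eta>)) \<le> I / (1 - 2 powr - a)"
    if \<eta>: "0 < \<eta>" for \<eta>
  proof -
    let ?S = "{y \<in> ball x (2 * R). \<eta> \<le> infdist y E}"
    have ind: "integrable lborel (\<lambda>y. (R / 2 ^ k) powr - a * indicator (B k \<inter> L \<eta>) y)" for k
      using fmeasurableD2[OF BL] fmeasurableD[OF BL]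
      by (intro integrable_mult_right integrable_real_indicator) (auto simp: less_top)
    have "(\<Sum>k=1..K. (R / 2 ^ k) powr - a * measure lborel (B k \<inter> L \<eta>))
        = (LINT y|lborel. (\<Sum>k=1..K. (R / 2 ^ k) powr - a * indicator (B k \<inter> L \<eta>) y))"
      by (subst Bochner_Integration.integral_sum[OF ind]) simp
    also have "\<dots> \<le> (LINT y|lborel. (indicator ?S y *\<^sub>R infdist y E powr - a) * (1 / (1 - 2 powr - a)))"
    proof (rule integral_mono')
      show "integrable lborel (\<lambda>y. (indicator ?S y *\<^sub>R infdist y E powr - a) * (1 / (1 - 2 powr - a)))"
        using set_integrable_infdist_powr[of "ball x (2 * R)" \<eta> E "- a"] \<eta>
        by (intro integrable_mult_left) (simp add: set_integrable_def)
      fix y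
      have "2 powr - a < (1::real)" using a powr_less_mono[of "- a" 0 2] by simp
      then show "0 \<le> (indicator ?S y *\<^sub>R infdist y E powr - a) * (1 / (1 - 2 powr - a))" by simp
      show "(\<Sum>k=1..K. (R / 2 ^ k) powr - a * indicator (B k \<inter> L \<eta>) y)
        \<le> (indicator ?S y *\<^sub>R infdist y E powr - a) * (1 / (1 - 2 powr - a))"
      proof (cases "y \<in> ?S")
        case True
        then have "(\<Sum>k=1..K. (R / 2 ^ k) powr - a * indicator (B k \<inter> L \<eta>) y)
          = (\<Sum>k=1..K. of_bool (infdist y E < R / 2 ^ k) * (R / 2 ^ k) powr - a)"
          by (intro sum.cong) (auto simp: B_def L_def indicator_def)
        also have "\<dots> \<le> infdist y E powr - a / (1 - 2 powr - a)"
          using True \<eta> by (intro geometric_layers a R) simp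
        finally show ?thesis using True by simp
      next
        case False
        then have "y \<notin> B k \<inter> L \<eta>" for k by (auto simp: B_def L_def)
        then show ?thesis using False by simp
      qed
    qed
    also have "\<dots> = (LINT y:?S|lborel. infdist y E powr - a) * (1 / (1 - 2 powr - a))"
      unfolding set_lebesgue_integral_def by (rule integral_mult_left_zero)
    also have "\<dots> \<le> I * (1 / (1 - 2 powr - a))"
    proof (rule mult_right_mono)
      show "(LINT y:?S|lborel. infdist y E powr - a) \<le> I" using int[OF \<eta>] a(2) by simp
      show "0 \<le> 1 / (1 - 2 powr - a)" using a powr_less_mono[of "- a" 0 2] by simp
    qed
    finally show ?thesis by simp
  qed
  have lim: "(\<lambda>j. measure lborel (B k \<inter> L (inverse (real (Suc j))))) \<longlonglongrightarrow> measure lborel (B k)" for k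
  proof -
    have "(\<lambda>j. measure lborel (B k \<inter> L (inverse (real (Suc j))))) \<longlonglongrightarrow>
        measure lborel (\<Union>j. B k \<inter> L (inverse (real (Suc j))))"
    proof (rule Lim_measure_incseq)
      show "range (\<lambda>j. B k \<inter> L (inverse (real (Suc j)))) \<subseteq> sets lborel"
        using fmeasurableD[OF BL] by blast
      have "inverse (real (Suc j)) \<le> inverse (real (Suc i))" if "i \<le> j" for i j
        using that by (intro le_imp_inverse_le) auto
      then have "L (inverse (real (Suc i))) \<subseteq> L (inverse (real (Suc j)))" if "i \<le> j" for i j
        using that unfolding L_def by (meson Collect_mono order_trans)
      then show "incseq (\<lambda>j. B k \<inter> L (inverse (real (Suc j))))"
        unfolding incseq_def by blast
      have "emeasure lborel (\<Union>j. B k \<inter> L (inverse (real (Suc j)))) \<le> emeasure lborel (B k)"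
        using fmeasurableD[OF B] by (intro emeasure_mono) auto
      then show "emeasure lborel (\<Union>j. B k \<inter> L (inverse (real (Suc j)))) \<noteq> \<infinity>"
        using fmeasurableD2[OF B[of k]] by (auto simp: top_unique)
    qed
    also have "(\<Union>j. B k \<inter> L (inverse (real (Suc j)))) = B k - E"
    proof -
      have "(\<exists>j. inverse (real (Suc j)) \<le> infdist y E) \<longleftrightarrow> y \<notin> E" for y
      proof -
        have "y \<notin> E \<longleftrightarrow> 0 < infdist y E"
          using in_closed_iff_infdist_zero[OF E(1,3), of y] infdist_nonneg[of y E] by linarith
        also have "\<dots> \<longleftrightarrow> (\<exists>j. inverse (real (Suc j)) \<le> infdist y E)"
          using reals_Archimedean[of "infdist y E"]
          by (meson inverse_positive_iff_positive less_imp_le of_nat_0_less_iff order_less_le_trans zero_less_Suc)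
        finally show ?thesis ..
      qed
      then show ?thesis unfolding L_def by blast
    qed
    also have "measure lborel (B k - E) = measure lborel (B k)"
      using E(2) fmeasurableD[OF B] by (intro measure_Diff_null_set) auto
    finally show ?thesis .
  qed
  have "(\<lambda>j. \<Sum>k=1..K. (R / 2 ^ k) powr - a * measure lborel (B k \<inter> L (inverse (real (Suc j))))) \<longlonglongrightarrow>
      (\<Sum>k=1..K. (R / 2 ^ k) powr - a * measure lborel (B k))"
    by (intro tendsto_sum tendsto_mult tendsto_const lim)
  then have "(\<Sum>k=1..K. (R / 2 ^ k) powr - a * measure lborel (B k)) \<le> I / (1 - 2 powr - a)"
    by (rule LIMSEQ_le_const2) (use trunc in auto)
  then show ?thesis unfolding B_def a(2) .
qed

text \<open>The integral of $\delta^{s-n}$ splits over dyadic layers into terms comparable to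
  \<open>N 2 ^ (- k s)\<close>, where \<open>N\<close> is the number of balls of radius $2^{-k} R$ needed.  Since the total is bounded
  independently of the number of layers, some layer among sufficiently many contributes little.
  This is what makes the dimension bound strict.\<close>

lemma assouad_dim_less:
  fixes E :: "'a::euclidean_space set" and C s :: real
  assumes E: "closed E" "E \<in> null_sets lborel" and s: "0 < s" "s < DIM('a)"
    and C: "0 \<le> C" and int: "\<And>x R \<eta>. x \<in> E \<Longrightarrow> 0 < R \<Longrightarrow> 0 < \<eta> \<Longrightarrow>
      (LINT y:{y \<in> ball x R. \<eta> \<le> infdist y E}|lborel. infdist y E powr (s - DIM('a))) \<le> C * R powr s"
  shows "assouad_dim E < ereal s"
proof -
  define \<omega> where "\<omega> = measure lborel (ball (0::'a) 1)"
  have \<omega>: "0 < \<omega>" unfolding \<omega>_def by (rule content_ball_pos) simp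
  define A where "A = 1 / (1 - 2 powr (s - DIM('a)))"
  define c where "c = \<omega> / (2 * 2 powr DIM('a))"
  have c: "0 < c" using \<omega> by (simp add: c_def)
  \<comment> \<open>The first bound keeps the improved exponent $s - 1/K$ nonnegative; the second makes \<open>K\<close> layers of
    size at least $c R^s$ exceed the available total.\<close>
  obtain K :: nat where K: "max (1 / s) (A * (C * 2 powr s) / c) < K"
    using reals_Archimedean2 by blast
  have K0: "0 < K" using K s by (metis gr0I max_less_iff_conj not_less_iff_gr_or_eq of_nat_0 zero_less_divide_1_iff)
  have K1: "1 / real K \<le> s" using K K0 s by (simp add: field_simps)
  have K2: "A * (C * 2 powr s) < K * c" using K c by (simp add: pos_divide_less_eq)
  have "assouad_dim E \<le> ereal (s - 1 / K)"
  proof (rule assouad_dim_le_iterate[OF K0 K1], rule ccontr)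
    fix x R assume x: "x \<in> E" and R: "0 < (R::real)"
    assume neg: "\<nexists>k S. 1 \<le> k \<and> k \<le> K \<and> finite S \<and> S \<subseteq> E \<and>
      real (card S) \<le> 2 powr (k * s) / 2 \<and> E \<inter> ball x R \<subseteq> (\<Union>y\<in>S. ball y (R / 2 ^ k))"
    have layer: "c * R powr s \<le> (R / 2 ^ k) powr (s - DIM('a)) * measure lborel {y \<in> ball x (2 * R). infdist y E < R / 2 ^ k}"
      (is "_ \<le> _ * ?V") if k: "k \<in> {1..K}" for k
    proof -
      define r where "r = R / 2 ^ k"
      have r: "0 < r" "r \<le> R" using R by (auto simp: r_def pos_divide_le_eq)
      obtain S where S: "finite S" "S \<subseteq> E" "E \<inter> ball x R \<subseteq> (\<Union>s\<in>S. ball s r)"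
        "card S * \<omega> * (r / 2) powr DIM('a) \<le> ?V"
        by (rule cover_by_volume[OF r, of E x, folded \<omega>_def]) (rule that, unfold r_def)
      have "\<not> real (card S) \<le> 2 powr (k * s) / 2"
      proof
        assume "real (card S) \<le> 2 powr (k * s) / 2"
        then have "\<exists>k S. 1 \<le> k \<and> k \<le> K \<and> finite S \<and> S \<subseteq> E \<and>
          real (card S) \<le> 2 powr (k * s) / 2 \<and> E \<inter> ball x R \<subseteq> (\<Union>y\<in>S. ball y (R / 2 ^ k))"
          using S(1-3) k unfolding r_def by (intro exI[of _ k] exI[of _ S]) simp
        with neg show False by contradiction
      qed
      then have "2 powr (k * s) / 2 * \<omega> * (r / 2) powr DIM('a) \<le> card S * \<omega> * (r / 2) powr DIM('a)"
        using \<omega> by (intro mult_right_mono) auto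
      with S(4) have "2 powr (k * s) / 2 * \<omega> * (r / 2) powr DIM('a) \<le> ?V" by linarith
      then have "r powr (s - DIM('a)) * (2 powr (k * s) / 2 * \<omega> * (r / 2) powr DIM('a)) \<le> r powr (s - DIM('a)) * ?V"
        by (rule mult_left_mono) simp
      moreover have "r powr (s - DIM('a)) * (2 powr (k * s) / 2 * \<omega> * (r / 2) powr DIM('a)) = c * R powr s"
      proof -
        have "r powr (s - DIM('a)) * (2 powr (k * s) / 2 * \<omega> * (r / 2) powr DIM('a))
          = c * (2 powr (k * s) * (r powr (s - DIM('a)) * r powr DIM('a)))"
          by (simp add: c_def powr_divide)
        also have "r powr (s - DIM('a)) * r powr DIM('a) = r powr s"
          using r by (simp flip: powr_add)
        also have "2 powr (k * s) * r powr s = (2 ^ k * r) powr s"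
          by (simp add: powr_mult powr_powr flip: powr_realpow)
        also have "2 ^ k * r = R" by (simp add: r_def)
        finally show ?thesis .
      qed
      ultimately show ?thesis by (simp add: r_def)
    qed
    have "(\<Sum>k=1..K. c * R powr s) \<le> (\<Sum>k=1..K. (R / 2 ^ k) powr (s - DIM('a)) * measure lborel {y \<in> ball x (2 * R). infdist y E < R / 2 ^ k})"
      by (rule sum_mono) (rule layer)
    also have "\<dots> \<le> C * (2 * R) powr s / (1 - 2 powr (s - DIM('a)))"
      using x R by (intro volume_layers E s int) auto
    also have "\<dots> = A * (C * 2 powr s) * R powr s" by (simp add: A_def powr_mult)
    finally have "K * c * R powr s \<le> A * (C * 2 powr s) * R powr s" by simp
    then show False using K2 R by simp
  qed
  also have "ereal (s - 1 / K) < ereal s" using K0 by simp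
  finally show ?thesis .
qed

section \<open>Fine covers of sets of small dimension\<close>

text \<open>Radii below \<open>1\<close> have $r^n \le r^\tau$, so the total volume of a fine cover is small as well.\<close>

lemma fine_covers_imp_null:
  fixes E :: "'a::euclidean_space set"
  assumes E: "closed E" "fine_covers K \<tau> \<beta> E" and \<tau>: "\<tau> \<le> DIM('a)"
  shows "E \<in> null_sets lborel"
proof -
  define \<omega> where "\<omega> = measure lborel (ball (0::'a) 1)"
  have \<omega>: "0 < \<omega>" unfolding \<omega>_def by (rule content_ball_pos) simp
  have "E \<inter> cball 0 \<rho> \<in> null_sets lborel" for \<rho>
  proof -
    have bor: "E \<inter> cball 0 \<rho> \<in> sets lborel" using E(1) by simp
    have "measure lborel (E \<inter> cball 0 \<rho>) \<le> 0 + e" if e: "0 < e" for e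
    proof -
      define \<epsilon> where "\<epsilon> = min 1 (e / \<omega>)"
      have \<epsilon>: "0 < \<epsilon>" using e \<omega> by (simp add: \<epsilon>_def)
      obtain P where P: "finite P" "\<forall>(c, r)\<in>P. c \<in> E \<and> 0 < r \<and> r < \<epsilon>"
        "E \<inter> cball 0 \<rho> \<subseteq> (\<Union>(c, r)\<in>P. ball c r)" "(\<Sum>(c, r)\<in>P. r powr \<tau>) \<le> \<epsilon>"
        using E(2)[unfolded fine_covers_def, THEN spec, THEN mp, OF \<epsilon>, THEN spec, THEN spec, of 0 \<rho>]
        by (elim exE conjE) (rule that)
      have "measure lborel (E \<inter> cball 0 \<rho>) \<le> measure lborel (\<Union>b\<in>P. ball (fst b) (snd b))"
      proof (rule measure_mono_fmeasurable[OF _ bor])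
        show "E \<inter> cball 0 \<rho> \<subseteq> (\<Union>b\<in>P. ball (fst b) (snd b))" using P(3) by (simp add: case_prod_beta)
        show "(\<Union>b\<in>P. ball (fst b) (snd b)) \<in> fmeasurable lborel"
        proof (rule fmeasurableI)
          have "open (\<Union>b\<in>P. ball (fst b) (snd b))" by auto
          then show "(\<Union>b\<in>P. ball (fst b) (snd b)) \<in> sets lborel" by simp
          show "emeasure lborel (\<Union>b\<in>P. ball (fst b) (snd b)) < \<infinity>"
            using P(1) by (intro emeasure_bounded_finite bounded_UN) auto
        qed
      qed
      also have "\<dots> \<le> (\<Sum>b\<in>P. measure lborel (ball (fst b) (snd b)))"
        using P(1) by (intro measure_UNION_le) auto
      also have "\<dots> \<le> (\<Sum>b\<in>P. \<omega> * snd b powr \<tau>)"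
      proof (rule sum_mono)
        fix b assume "b \<in> P"
        then have b: "0 < snd b" "snd b \<le> 1" using P(2) by (auto simp: \<epsilon>_def)
        then show "measure lborel (ball (fst b) (snd b)) \<le> \<omega> * snd b powr \<tau>"
          using \<omega> \<tau> content_ball_scale[of "snd b" "fst b"]
          by (auto simp: \<omega>_def intro!: mult_left_mono powr_mono')
      qed
      also have "\<dots> = \<omega> * (\<Sum>(c, r)\<in>P. r powr \<tau>)"
        by (simp add: sum_distrib_left case_prod_beta)
      also have "\<dots> \<le> \<omega> * \<epsilon>" using P(4) \<omega> by (intro mult_left_mono) auto
      also have "\<dots> \<le> e" using \<omega> by (simp add: \<epsilon>_def min_def field_simps)
      finally show ?thesis by simp
    qed
    then have "measure lborel (E \<inter> cball 0 \<rho>) = 0"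
      using field_le_epsilon[of "measure lborel (E \<inter> cball 0 \<rho>)" 0] measure_nonneg
      by (metis order_antisym)
    moreover have "emeasure lborel (E \<inter> cball 0 \<rho>) < \<infinity>"
      by (intro emeasure_bounded_finite bounded_Int) simp
    ultimately show ?thesis
      using bor by (intro null_setsI) (auto simp: emeasure_eq_ennreal_measure less_top)
  qed
  then have "(\<Union>j. E \<inter> cball 0 (real j)) \<in> null_sets lborel" by (intro null_sets_UN) blast
  also have "(\<Union>j. E \<inter> cball 0 (real j)) = E"
    using real_arch_simple by auto
  finally show ?thesis .
qed

lemma frontier_null_closed:
  fixes E :: "'a::euclidean_space set"
  assumes "closed E" "E \<in> null_sets lborel"
  shows "frontier E = E"
proof -
  have "interior E = {}"
  proof (rule ccontr)
    assume "interior E \<noteq> {}"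
    then obtain x r where r: "0 < r" "ball x r \<subseteq> E"
      using mem_interior by blast
    then have "ball x r \<in> null_sets lborel"
      by (intro null_sets_subset[OF assms(2)]) auto
    then have "measure lborel (ball x r) = 0" by (simp add: null_sets_def measure_def)
    then show False using content_ball_pos[OF r(1), of x] by simp
  qed
  then show ?thesis using assms(1) by (simp add: frontier_def)
qed

text \<open>The radii exceed the diameters of the covering sets, so that the balls are open and still cover,
  but only by as much as costs $2^{-i}$ of the remaining room in the sum of powers.\<close>

lemma fine_covers_hausdorff:
  fixes E :: "'a::euclidean_space set"
  assumes E: "closed E" and dim: "hausdorff_dim E < ereal \<tau>" and \<beta>: "0 \<le> \<beta>"
  shows "fine_covers (2 powr \<beta>) \<tau> \<beta> E"
proof -
  obtain t where t: "0 \<le> t" "t < \<tau>" "hausdorff_measure t E = 0"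
    using dim unfolding hausdorff_dim_def Inf_less_iff by auto
  have \<tau>: "0 < \<tau>" using t by simp
  show ?thesis
    unfolding fine_covers_def
  proof (intro allI impI)
    fix \<epsilon> :: real and x :: 'a and \<rho> :: real
    assume \<epsilon>: "0 < \<epsilon>"
    define e where "e = min \<epsilon> 1"
    have e: "0 < e" "e \<le> 1" "e \<le> \<epsilon>" using \<epsilon> by (auto simp: e_def)
    have "hausdorff_premeasure t (e / 2) E \<le> hausdorff_measure t E"
      unfolding hausdorff_measure_def using e by (intro SUP_upper) simp
    then have "hausdorff_premeasure t (e / 2) E < ennreal (\<epsilon> / 2)"
      using t(3) \<epsilon> by (simp add: less_le_trans)
    then obtain U where U: "E \<subseteq> (\<Union>i. U i)" "\<forall>i. bounded (U i) \<and> diameter (U i) \<le> e / 2"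
        "(\<Sum>i. hausdorff_gauge t (U i)) < ennreal (\<epsilon> / 2)"
      unfolding hausdorff_premeasure_def INF_less_iff by (elim bexE CollectE conjE) (rule that)
    have bdd: "bounded (U i)" and d: "0 \<le> diameter (U i)" "diameter (U i) \<le> e / 2" for i
      using U(2) diameter_ge_0[of "U i"] by auto
    \<comment> \<open>A quarter of the room between the diameters and the bound \<open>e\<close> on the radii, after taking
      \<open>\<tau>\<close>-th powers, and of the bound on the sum.\<close>
    define g where "g = min (e powr \<tau> - (e / 2) powr \<tau>) \<epsilon> / 4"
    have g: "0 < g" "4 * g \<le> e powr \<tau> - (e / 2) powr \<tau>" "4 * g \<le> \<epsilon>"
      using \<epsilon> \<tau> powr_less_mono2[of \<tau> "e / 2" e] e by (auto simp: g_def)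
    define r where "r i = (diameter (U i) powr \<tau> + g * (1 / 2) ^ i) powr (1 / \<tau>)" for i
    have r_powr: "r i powr \<tau> = diameter (U i) powr \<tau> + g * (1 / 2) ^ i" for i
      using g \<tau> by (simp add: r_def powr_powr add_nonneg_nonneg)
    have gi: "0 < g * (1 / 2) ^ i" "g * (1 / 2) ^ i \<le> g" for i
      using g power_le_one[of "1 / 2 :: real" i] by (auto simp: mult_left_le)
    have r_gt: "diameter (U i) < r i" for i
    proof (rule ccontr)
      assume "\<not> ?thesis"
      then have "r i powr \<tau> \<le> diameter (U i) powr \<tau>"
        using \<tau> by (intro powr_mono2) (auto simp: r_def)
      then show False using r_powr[of i] gi[of i] by simp
    qed
    have r_lt: "r i < e" for i
    proof (rule ccontr)
      assume "\<not> ?thesis"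
      then have "e powr \<tau> \<le> r i powr \<tau>" using \<tau> e by (intro powr_mono2) auto
      moreover have "diameter (U i) powr \<tau> \<le> (e / 2) powr \<tau>"
        using d \<tau> by (intro powr_mono2) auto
      ultimately show False using r_powr[of i] gi[of i] g by linarith
    qed
    have r_pos: "0 < r i" for i using r_gt[of i] d(1)[of i] by linarith
    define I where "I = {i. U i \<inter> E \<noteq> {}}"
    define c where "c i = (SOME z. z \<in> U i \<inter> E)" for i
    have c: "c i \<in> U i \<inter> E" if "i \<in> I" for i
    proof -
      have "\<exists>z. z \<in> U i \<inter> E" using that by (auto simp: I_def)
      then show ?thesis unfolding c_def by (rule someI_ex)
    qed
    have comp: "compact (E \<inter> cball x \<rho>)" using E by (intro closed_Int_compact) auto
    have cov: "E \<inter> cball x \<rho> \<subseteq> (\<Union>i\<in>I. ball (c i) (r i))"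
    proof
      fix z assume z: "z \<in> E \<inter> cball x \<rho>"
      then obtain i where i: "z \<in> U i" using U(1) by blast
      then have "i \<in> I" using z unfolding I_def by blast
      have "dist (c i) z \<le> diameter (U i)"
        using c[OF \<open>i \<in> I\<close>] i bdd by (intro diameter_bounded_bound) auto
      then have "z \<in> ball (c i) (r i)" using r_gt[of i] by simp
      with \<open>i \<in> I\<close> show "z \<in> (\<Union>i\<in>I. ball (c i) (r i))" by blast
    qed
    obtain J where J: "J \<subseteq> I" "finite J" "E \<inter> cball x \<rho> \<subseteq> (\<Union>i\<in>J. ball (c i) (r i))"
      by (rule compactE_image[OF comp _ cov]) (simp, rule that)
    define P where "P = (\<lambda>i. (c i, r i)) ` J"
    have sum: "(\<Sum>(c, r)\<in>P. r powr \<tau>) \<le> \<epsilon>"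
    proof -
      have "(\<Sum>(c, r)\<in>P. r powr \<tau>) \<le> (\<Sum>i\<in>J. r i powr \<tau>)"
        unfolding P_def using sum_image_le[OF J(2), of "\<lambda>(c, r). r powr \<tau>" "\<lambda>i. (c i, r i)"]
        by (simp add: comp_def)
      also have "\<dots> = (\<Sum>i\<in>J. diameter (U i) powr \<tau>) + g * (\<Sum>i\<in>J. (1 / 2) ^ i)"
        by (simp add: r_powr sum.distrib sum_distrib_left)
      also have "(\<Sum>i\<in>J. (1 / 2) ^ i :: real) \<le> (\<Sum>i. (1 / 2) ^ i)"
        by (intro sum_le_suminf J summable_geometric) auto
      also have "(\<Sum>i. (1 / 2) ^ i :: real) = 2" by (simp add: suminf_geometric)
      also have "(\<Sum>i\<in>J. diameter (U i) powr \<tau>) \<le> \<epsilon> / 2"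
      proof -
        have "ennreal (\<Sum>i\<in>J. diameter (U i) powr \<tau>) = (\<Sum>i\<in>J. ennreal (diameter (U i) powr \<tau>))"
          by simp
        also have "\<dots> \<le> (\<Sum>i\<in>J. hausdorff_gauge t (U i))"
        proof (rule sum_mono)
          fix i assume "i \<in> J"
          then have ne: "U i \<noteq> {}" using J(1) by (auto simp: I_def)
          \<comment> \<open>Diameters at most \<open>1\<close> make the larger exponent \<open>\<tau>\<close> give the smaller power; for \<open>t = 0\<close> the gauge is \<open>1\<close>.\<close>
          have d1: "diameter (U i) \<le> 1" using d[of i] e by linarith
          show "ennreal (diameter (U i) powr \<tau>) \<le> hausdorff_gauge t (U i)"
          proof (cases "t = 0")
            case True
            then show ?thesis
              using ne d[of i] d1 \<tau> powr_le1[of \<tau> "diameter (U i)"] by (simp add: hausdorff_gauge_def)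
          next
            case False
            then show ?thesis
              using ne d[of i] d1 t powr_mono'[of t \<tau> "diameter (U i)"]
              by (simp add: hausdorff_gauge_def ennreal_leI)
          qed
        qed
        also have "\<dots> \<le> (\<Sum>i. hausdorff_gauge t (U i))"
          using J(2) by (intro sum_le_suminf) auto
        also have "\<dots> \<le> ennreal (\<epsilon> / 2)" using U(3) by simp
        finally show ?thesis using \<epsilon> by (simp add: ennreal_le_iff)
      qed
      finally show ?thesis using g by simp
    qed
    show "\<exists>P. finite P \<and> (\<forall>(c, r)\<in>P. c \<in> E \<and> 0 < r \<and> r < \<epsilon>) \<and>
      E \<inter> cball x \<rho> \<subseteq> (\<Union>(c, r)\<in>P. ball c r) \<and> (\<Sum>(c, r)\<in>P. r powr \<tau>) \<le> \<epsilon> \<and>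
      (\<forall>(c, r)\<in>P. \<forall>y\<in>ball c (2 * r) - (\<Union>(c, r)\<in>P. ball c r) - E.
        infdist y E powr \<beta> \<le> 2 powr \<beta> * r powr \<beta>)"
    proof (intro exI[of _ P] conjI)
      show "finite P" using J(2) by (simp add: P_def)
      show "\<forall>(c, r)\<in>P. c \<in> E \<and> 0 < r \<and> r < \<epsilon>"
        using c J(1) r_pos less_le_trans[OF r_lt e(3)] unfolding P_def by auto
      show "E \<inter> cball x \<rho> \<subseteq> (\<Union>(c, r)\<in>P. ball c r)" using J(3) by (simp add: P_def)
      show "(\<Sum>(c, r)\<in>P. r powr \<tau>) \<le> \<epsilon>" by (rule sum)
      have "infdist y E powr \<beta> \<le> 2 powr \<beta> * r i powr \<beta>" if i: "i \<in> J" and y: "y \<in> ball (c i) (2 * r i)" for i y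
      proof -
        have "infdist y E \<le> dist y (c i)" using c[of i] i J(1) by (intro infdist_le) auto
        then have "infdist y E powr \<beta> \<le> (2 * r i) powr \<beta>"
          using y \<beta> by (intro powr_mono2 infdist_nonneg) (auto simp: dist_commute)
        then show ?thesis by (simp add: powr_mult)
      qed
      then show "\<forall>(c, r)\<in>P. \<forall>y\<in>ball c (2 * r) - (\<Union>(c, r)\<in>P. ball c r) - E.
          infdist y E powr \<beta> \<le> 2 powr \<beta> * r powr \<beta>"
        unfolding P_def by simp
    qed
  qed
qed

lemma finite_cover_of_covering_number:
  assumes "compact E" "0 < r"
  obtains S where "S \<subseteq> E" "finite S" "card S = covering_number E r" "E \<subseteq> (\<Union>x\<in>S. ball x r)"
proof -
  obtain S where "S \<subseteq> E" "finite S" "E \<subseteq> (\<Union>x\<in>S. ball x r)"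
    using compactE_image[OF assms(1), of E "\<lambda>x. ball x r"] assms(2) by force
  then have "\<exists>m S. S \<subseteq> E \<and> finite S \<and> card S = m \<and> E \<subseteq> (\<Union>x\<in>S. ball x r)" by blast
  from LeastI_ex[OF this] show ?thesis
    unfolding covering_number_def[symmetric] by (elim exE conjE) (rule that)
qed

text \<open>The balls are taken with twice the covering radius: a point outside all of them is then at
  distance at least half their radius from \<open>E\<close>, which bounds the singular weight.\<close>

lemma fine_covers_minkowski:
  fixes E :: "'a::euclidean_space set"
  assumes E: "compact E" and dim: "lower_minkowski_dim E < ereal \<tau>" and \<beta>: "\<beta> \<le> 0"
  shows "fine_covers (2 powr - \<beta>) \<tau> \<beta> E"
proof -
  let ?F = "\<lambda>t r. ereal (real (covering_number E r) * r powr t)"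
  obtain t where t: "0 \<le> t" "t < \<tau>" "Liminf (at_right 0) (?F t) = 0"
    using dim unfolding lower_minkowski_dim_def Inf_less_iff by auto
  have small: "\<exists>r. 0 < r \<and> r < d \<and> real (covering_number E r) * r powr t < d'" if d: "0 < d" "0 < d'" for d d'
  proof (rule ccontr)
    assume "\<not> ?thesis"
    then have neg: "d' \<le> real (covering_number E r) * r powr t" if "0 < r" "r < d" for r
      using that by (meson not_le)
    have "\<forall>\<^sub>F r in at_right 0. ereal d' \<le> ?F t r"
      using neg d by (auto simp: eventually_at_right_field)
    then have "ereal d' \<le> Liminf (at_right 0) (?F t)" by (rule Liminf_bounded)
    then show False using t(3) d by simp
  qed
  show ?thesis
    unfolding fine_covers_def
  proof (intro allI impI)
    fix \<epsilon> :: real and x :: 'a and \<rho> :: real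
    assume \<epsilon>: "0 < \<epsilon>"
    obtain r where r: "0 < r" "r < min \<epsilon> 1 / 2" "real (covering_number E r) * r powr t < \<epsilon> / 2 powr \<tau>"
      using small[of "min \<epsilon> 1 / 2" "\<epsilon> / 2 powr \<tau>"] \<epsilon> by auto
    obtain S where S: "S \<subseteq> E" "finite S" "card S = covering_number E r" "E \<subseteq> (\<Union>x\<in>S. ball x r)"
      using finite_cover_of_covering_number[OF E r(1)] by blast
    define P where "P = (\<lambda>c. (c, 2 * r)) ` S"
    show "\<exists>P. finite P \<and> (\<forall>(c, r)\<in>P. c \<in> E \<and> 0 < r \<and> r < \<epsilon>) \<and>
      E \<inter> cball x \<rho> \<subseteq> (\<Union>(c, r)\<in>P. ball c r) \<and> (\<Sum>(c, r)\<in>P. r powr \<tau>) \<le> \<epsilon> \<and>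
      (\<forall>(c, r)\<in>P. \<forall>y\<in>ball c (2 * r) - (\<Union>(c, r)\<in>P. ball c r) - E.
        infdist y E powr \<beta> \<le> 2 powr - \<beta> * r powr \<beta>)"
    proof (intro exI[of _ P] conjI)
      show "finite P" using S by (simp add: P_def)
      show "\<forall>(c, r)\<in>P. c \<in> E \<and> 0 < r \<and> r < \<epsilon>" using S r by (auto simp: P_def)
      show "E \<inter> cball x \<rho> \<subseteq> (\<Union>(c, r)\<in>P. ball c r)"
      proof
        fix z assume "z \<in> E \<inter> cball x \<rho>"
        then obtain s where "s \<in> S" "dist s z < r" using S(4) by auto
        then show "z \<in> (\<Union>(c, r)\<in>P. ball c r)" using r(1) by (force simp: P_def)
      qed
      have "(\<Sum>(c, r)\<in>P. r powr \<tau>) = card S * (2 * r) powr \<tau>"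
        unfolding P_def by (subst sum.reindex) (auto simp: inj_on_def)
      also have "\<dots> = 2 powr \<tau> * (covering_number E r * r powr \<tau>)"
        using S(3) by (simp add: powr_mult)
      also have "\<dots> \<le> 2 powr \<tau> * (covering_number E r * r powr t)"
        using r t by (intro mult_left_mono powr_mono') auto
      also have "\<dots> \<le> 2 powr \<tau> * (\<epsilon> / 2 powr \<tau>)" using r(3) by (intro mult_left_mono) auto
      finally show "(\<Sum>(c, r)\<in>P. r powr \<tau>) \<le> \<epsilon>" by simp
      have "infdist y E powr \<beta> \<le> 2 powr - \<beta> * (2 * r) powr \<beta>"
        if s: "s \<in> S" and y: "y \<notin> (\<Union>c\<in>S. ball c (2 * r))" for s y
      proof -
        have "r \<le> dist y z" if z: "z \<in> E" for z
        proof -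
          obtain c where c: "c \<in> S" "dist c z < r" using S(4) z by auto
          then have "2 * r \<le> dist c y" using y by auto
          then show ?thesis using c dist_triangle[of c y z] by (simp add: dist_commute)
        qed
        then have "r \<le> infdist y E"
          using s S(1) by (intro infdist_geI) auto
        then have "infdist y E powr \<beta> \<le> r powr \<beta>" using r(1) \<beta> by (intro powr_mono2') auto
        also have "\<dots> = 2 powr - \<beta> * (2 * r) powr \<beta>" by (simp add: powr_mult powr_minus)
        finally show ?thesis .
      qed
      then show "\<forall>(c, r)\<in>P. \<forall>y\<in>ball c (2 * r) - (\<Union>(c, r)\<in>P. ball c r) - E.
          infdist y E powr \<beta> \<le> 2 powr - \<beta> * r powr \<beta>"
        unfolding P_def by simp
    qed
  qed
qed

section \<open>The dichotomy\<close>

lemma set_lint_le_const_ball: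
  fixes f :: "'a::euclidean_space \<Rightarrow> real"
  assumes "A \<subseteq> ball x r" "\<And>y. y \<in> A \<Longrightarrow> f y \<le> c" "0 \<le> c"
  shows "(LINT y:A|lborel. f y) \<le> c * measure lborel (ball x r)"
proof -
  have fin: "emeasure lborel (ball x r) < \<infinity>" by (rule emeasure_lborel_ball_finite)
  have "(LINT y:A|lborel. f y) \<le> (LINT y|lborel. c * indicator (ball x r) y)"
    unfolding set_lebesgue_integral_def
  proof (rule integral_mono')
    show "integrable lborel (\<lambda>y. c * indicator (ball x r) y)"
      using fin by (intro integrable_mult_right integrable_real_indicator) simp_all
    show "indicator A y *\<^sub>R f y \<le> c * indicator (ball x r) y" for y
      using assms by (auto simp: indicator_def)
    show "0 \<le> c * indicator (ball x r) y" for y using assms(3) by simp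
  qed
  then show ?thesis by simp
qed

text \<open>For $\beta \ge 0$ the weight is at most $(2R)^\beta$ on the doubled ball, because the centre
  lies in \<open>E\<close>.\<close>

lemma distance_integral_bound_nonneg:
  fixes E :: "(real ^ 'n::finite) set" and p q \<beta> :: real
  defines "n \<equiv> real CARD('n)"
  defines "\<tau> \<equiv> n - p + \<beta>"
  defines "\<sigma> \<equiv> q / p * \<tau> - n"
  assumes hs: "hardy_sobolev q p \<beta> (- E)" and E: "closed E" "E \<noteq> {}" "frontier E = E"
    and p: "1 \<le> p" "p \<le> q" and K: "0 \<le> K" "fine_covers K \<tau> \<beta> E" and \<beta>: "0 \<le> \<beta>"
  shows "\<exists>C\<ge>0. \<forall>x\<in>E. \<forall>R>0. \<forall>\<eta>>0.
    (LINT y:{y \<in> ball x R. \<eta> \<le> infdist y E}|lborel. infdist y E powr \<sigma>) \<le> C * R powr (n + \<sigma>)"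
proof -
  define \<omega> where "\<omega> = measure lborel (ball (0 :: real ^ 'n) 1)"
  obtain C where C: "0 < C" "\<And>x R D \<eta>. 0 < R \<Longrightarrow> 0 < \<eta> \<Longrightarrow> 0 \<le> D \<Longrightarrow>
    (\<And>\<rho>. 0 < \<rho> \<Longrightarrow> (LINT y:{y \<in> ball x (2 * R) - ball x R. \<rho> \<le> infdist y E}|lborel.
        infdist y E powr \<beta>) \<le> D * R powr (n + \<beta>)) \<Longrightarrow>
    (LINT y:{y \<in> ball x R. \<eta> \<le> infdist y E}|lborel. infdist y E powr \<sigma>)
      \<le> C * (D + 1) powr (q / p) * R powr (n + \<sigma>)"
    by (rule hardy_sobolev_ball[OF hs E p K[unfolded \<tau>_def n_def], folded n_def, folded \<tau>_def, folded \<sigma>_def])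
      (rule that, assumption, blast)
  define D where "D = 2 powr \<beta> * (\<omega> * 2 powr n)"
  have D: "0 \<le> D" by (simp add: D_def \<omega>_def)
  have "(LINT y:{y \<in> ball x R. \<eta> \<le> infdist y E}|lborel. infdist y E powr \<sigma>)
      \<le> C * (D + 1) powr (q / p) * R powr (n + \<sigma>)" if x: "x \<in> E" "0 < R" "0 < \<eta>" for x R \<eta>
  proof (rule C(2)[OF x(2,3) D])
    fix \<rho> :: real assume "0 < \<rho>"
    have "(LINT y:{y \<in> ball x (2 * R) - ball x R. \<rho> \<le> infdist y E}|lborel. infdist y E powr \<beta>)
      \<le> (2 * R) powr \<beta> * measure lborel (ball x (2 * R))"
    proof (rule set_lint_le_const_ball)
      fix y assume y: "y \<in> {y \<in> ball x (2 * R) - ball x R. \<rho> \<le> infdist y E}"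
      then show "infdist y E powr \<beta> \<le> (2 * R) powr \<beta>"
        using infdist_le[OF x(1), of y] \<beta>
        by (intro powr_mono2 infdist_nonneg) (auto simp: dist_commute)
    qed auto
    also have "\<dots> = D * R powr (n + \<beta>)"
      using x content_ball_scale[of "2 * R" x]
      by (simp add: D_def \<omega>_def n_def powr_mult powr_add mult_ac)
    finally show "(LINT y:{y \<in> ball x (2 * R) - ball x R. \<rho> \<le> infdist y E}|lborel. infdist y E powr \<beta>)
      \<le> D * R powr (n + \<beta>)" .
  qed
  then show ?thesis
    using C(1) by (intro exI[of _ "C * (D + 1) powr (q / p)"]) simp
qed

text \<open>Young's inequality with the balance between the two terms chosen so that
  $M^{1/\gamma}$ bounds the first term, too, once the average of $u^\gamma$ is at most \<open>M\<close>.\<close>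

lemma powr_young:
  fixes u M \<gamma> :: real
  assumes u: "0 < u" and M: "0 < M" and \<gamma>: "1 < \<gamma>"
  shows "u \<le> M powr (1 / \<gamma> - 1) * u powr \<gamma> + M powr (1 / \<gamma>)"
proof (cases "u \<le> M powr (1 / \<gamma>)")
  case False
  then have "(M powr (1 / \<gamma>)) powr (\<gamma> - 1) \<le> u powr (\<gamma> - 1)"
    using \<gamma> by (intro powr_mono2) auto
  moreover have "(M powr (1 / \<gamma>)) powr (\<gamma> - 1) = M powr (1 - 1 / \<gamma>)"
    using \<gamma> by (simp add: powr_powr field_simps)
  ultimately have "M powr (1 / \<gamma> - 1) * M powr (1 - 1 / \<gamma>) * u \<le> M powr (1 / \<gamma> - 1) * u powr (\<gamma> - 1) * u"
    using u by (intro mult_right_mono mult_left_mono) auto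
  moreover have "M powr (1 / \<gamma> - 1) * M powr (1 - 1 / \<gamma>) = 1"
    using M by (simp flip: powr_add)
  moreover have "u powr (\<gamma> - 1) * u = u powr \<gamma>" using u by (simp add: powr_diff)
  ultimately have "u \<le> M powr (1 / \<gamma> - 1) * u powr \<gamma>" by (simp add: mult.assoc)
  then show ?thesis by (simp add: add_increasing2)
qed (simp add: add_increasing)

text \<open>For $\beta < 0$ the energy of the bump has no evident bound, since the weight is singular on \<open>E\<close>.
  The estimate is therefore propagated from large to small radii.  For \<open>R\<close> larger than twice the diameter of \<open>E\<close>,
  the gradient of the bump lives at distance comparable to \<open>R\<close> from \<open>E\<close>.
  For the step from \<open>2 R\<close> to \<open>R\<close>, write $\gamma = \sigma / \beta$.  If the integral of $\delta^\sigma$ over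
  the doubled ball is at most \<open>M\<close> in the natural units, then Young's inequality bounds the
  integral of $\delta^\beta$ by a multiple of $M^{1/\gamma}$, and the Hardy--Sobolev inequality
  returns a multiple of $M^\theta$ with $\theta = q / (p \gamma)$.  The condition $q < np/(n-p)$ says exactly
  that $\theta < 1$; hence a large enough \<open>M\<close> reproduces itself and serves all radii.\<close>

lemma distance_integral_bound_neg:
  fixes E :: "(real ^ 'n::finite) set" and p q \<beta> :: real
  defines "n \<equiv> real CARD('n)"
  defines "\<tau> \<equiv> n - p + \<beta>"
  defines "\<sigma> \<equiv> q / p * \<tau> - n"
  assumes hs: "hardy_sobolev q p \<beta> (- E)" and E: "compact E" "E \<noteq> {}" "frontier E = E"
    and p: "1 \<le> p" "p \<le> q" "p < n" "q < n * p / (n - p)" and K: "0 \<le> K" "fine_covers K \<tau> \<beta> E" and \<beta>: "\<beta> < 0"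
  shows "\<exists>C\<ge>0. \<forall>x\<in>E. \<forall>R>0. \<forall>\<eta>>0.
    (LINT y:{y \<in> ball x R. \<eta> \<le> infdist y E}|lborel. infdist y E powr \<sigma>) \<le> C * R powr (n + \<sigma>)"
proof -
  let ?d = "\<lambda>y. infdist y E"
  define \<omega> where "\<omega> = measure lborel (ball (0 :: real ^ 'n) 1)"
  have \<omega>: "0 \<le> \<omega>" by (simp add: \<omega>_def)
  have vol: "measure lborel (ball x (2 * R)) = \<omega> * 2 powr n * R powr n" if "0 < R" for x :: "real ^ 'n" and R
    using that content_ball_scale[of "2 * R" x] by (simp add: \<omega>_def n_def powr_mult)
  obtain C where C: "0 < C" "\<And>x R D \<eta>. 0 < R \<Longrightarrow> 0 < \<eta> \<Longrightarrow> 0 \<le> D \<Longrightarrow>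
    (\<And>\<rho>. 0 < \<rho> \<Longrightarrow> (LINT y:{y \<in> ball x (2 * R) - ball x R. \<rho> \<le> ?d y}|lborel.
        ?d y powr \<beta>) \<le> D * R powr (n + \<beta>)) \<Longrightarrow>
    (LINT y:{y \<in> ball x R. \<eta> \<le> ?d y}|lborel. ?d y powr \<sigma>)
      \<le> C * (D + 1) powr (q / p) * R powr (n + \<sigma>)"
    by (rule hardy_sobolev_ball[OF hs compact_imp_closed[OF E(1)] E(2,3) p(1,2) K[unfolded \<tau>_def n_def],
          folded n_def, folded \<tau>_def, folded \<sigma>_def])
      (rule that, assumption, blast)
  define \<gamma> where "\<gamma> = \<sigma> / \<beta>"
  define \<theta> where "\<theta> = q / p / \<gamma>"
  have q_less: "q / p * (n - p) < n"
    using p by (simp add: field_simps)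
  have "\<sigma> = q / p * (n - p) + q / p * \<beta> - n" by (simp only: \<sigma>_def \<tau>_def distrib_left)
  with q_less have \<sigma>: "\<sigma> < q / p * \<beta>" by linarith
  have \<gamma>: "q / p < \<gamma>" using \<sigma> \<beta> by (simp add: \<gamma>_def less_divide_eq)
  have qp: "1 \<le> q / p" using p by simp
  have \<gamma>1: "1 < \<gamma>" using \<gamma> qp by linarith
  have \<theta>: "\<theta> < 1" unfolding \<theta>_def using \<gamma> \<gamma>1 by (subst pos_divide_less_eq) linarith+
  have \<beta>\<gamma>: "\<beta> * \<gamma> = \<sigma>" using \<beta> by (simp add: \<gamma>_def)
  define D0 where "D0 = 2 powr - \<beta> * (\<omega> * 2 powr n)"
  define C2 where "C2 = 2 powr (n + \<sigma>) + \<omega> * 2 powr n"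
  define C3 where "C3 = C * (C2 + 1) powr (q / p)"
  have pos: "0 \<le> D0" "0 \<le> C2" using \<omega> by (simp_all add: D0_def C2_def)
  then have C3: "0 < C3" using C(1) by (simp add: C3_def)
  \<comment> \<open>Large enough for the initial scales and, by the last entry, for $C_3 M^\theta \le M$.\<close>
  define M where "M = max (max 1 (C * (D0 + 1) powr (q / p))) (C3 powr (1 / (1 - \<theta>)))"
  have M: "1 \<le> M" "C * (D0 + 1) powr (q / p) \<le> M" "C3 powr (1 / (1 - \<theta>)) \<le> M"
    by (auto simp: M_def)
  have C3M: "C3 * M powr \<theta> \<le> M"
  proof -
    have "C3 = (C3 powr (1 / (1 - \<theta>))) powr (1 - \<theta>)" using \<theta> C3 by (simp add: powr_powr)
    also have "\<dots> \<le> M powr (1 - \<theta>)" using M \<theta> by (intro powr_mono2) auto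
    finally have "C3 * M powr \<theta> \<le> M powr (1 - \<theta>) * M powr \<theta>" by (intro mult_right_mono) auto
    also have "\<dots> = M" using M by (simp flip: powr_add)
    finally show ?thesis .
  qed
  define Q where "Q R \<longleftrightarrow> (\<forall>x\<in>E. \<forall>\<eta>>0.
    (LINT y:{y \<in> ball x R. \<eta> \<le> ?d y}|lborel. ?d y powr \<sigma>) \<le> M * R powr (n + \<sigma>))" for R
  have large: "Q R" if R: "2 * diameter E + 1 \<le> R" for R
    unfolding Q_def
  proof (intro ballI allI impI)
    fix x and \<eta> :: real assume x: "x \<in> E" and \<eta>: "0 < \<eta>"
    have bE: "bounded E" using E(1) by (rule compact_imp_bounded)
    have R0: "0 < R" using R diameter_ge_0[OF bE] by linarith
    have "(LINT y:{y \<in> ball x R. \<eta> \<le> ?d y}|lborel. ?d y powr \<sigma>) \<le> C * (D0 + 1) powr (q / p) * R powr (n + \<sigma>)"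
    proof (rule C(2)[OF R0 \<eta> pos(1)])
      fix \<rho> :: real assume "0 < \<rho>"
      have "(LINT y:{y \<in> ball x (2 * R) - ball x R. \<rho> \<le> ?d y}|lborel. ?d y powr \<beta>)
        \<le> (R / 2) powr \<beta> * measure lborel (ball x (2 * R))"
      proof (rule set_lint_le_const_ball)
        fix y assume y: "y \<in> {y \<in> ball x (2 * R) - ball x R. \<rho> \<le> ?d y}"
        have "R / 2 \<le> dist y z" if "z \<in> E" for z
          using diameter_bounded_bound[OF bE x that] dist_triangle[of x y z] y R by (auto simp: dist_commute)
        then have "R / 2 \<le> ?d y"
          by (rule infdist_geI[OF E(2)])
        then show "?d y powr \<beta> \<le> (R / 2) powr \<beta>" using R0 \<beta> by (intro powr_mono2') auto
      qed auto
      also have "\<dots> = D0 * R powr (n + \<beta>)"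
        unfolding vol[OF R0] by (simp add: D0_def powr_divide powr_minus powr_add field_simps)
      finally show "(LINT y:{y \<in> ball x (2 * R) - ball x R. \<rho> \<le> ?d y}|lborel. ?d y powr \<beta>) \<le> D0 * R powr (n + \<beta>)" .
    qed
    also have "\<dots> \<le> M * R powr (n + \<sigma>)" using M by (intro mult_right_mono) auto
    finally show "(LINT y:{y \<in> ball x R. \<eta> \<le> ?d y}|lborel. ?d y powr \<sigma>) \<le> M * R powr (n + \<sigma>)" .
  qed
  have step: "Q R" if R: "0 < R" and Q: "Q (2 * R)" for R
    unfolding Q_def
  proof (intro ballI allI impI)
    fix x and \<eta> :: real assume x: "x \<in> E" and \<eta>: "0 < \<eta>"
    have "0 \<le> M powr (1 / \<gamma>) * C2" using pos by simp
    then have "(LINT y:{y \<in> ball x R. \<eta> \<le> ?d y}|lborel. ?d y powr \<sigma>)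
      \<le> C * (M powr (1 / \<gamma>) * C2 + 1) powr (q / p) * R powr (n + \<sigma>)"
    proof (rule C(2)[OF R \<eta>])
      fix \<rho> :: real assume \<rho>: "0 < \<rho>"
      let ?A = "{y \<in> ball x (2 * R) - ball x R. \<rho> \<le> ?d y}"
      let ?S = "{y \<in> ball x (2 * R). \<rho> \<le> ?d y}"
      let ?c = "M powr (1 / \<gamma> - 1) * R powr (\<beta> - \<sigma>)"
      let ?b = "M powr (1 / \<gamma>) * R powr \<beta>"
      have young: "?d y powr \<beta> \<le> ?c * ?d y powr \<sigma> + ?b" if y: "\<rho> \<le> ?d y" for y
      proof -
        define u where "u = (?d y / R) powr \<beta>"
        have u: "0 < u" using y \<rho> R by (simp add: u_def)
        have "?d y powr \<beta> = R powr \<beta> * u" using R by (simp add: u_def powr_divide)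
        also have "\<dots> \<le> R powr \<beta> * (M powr (1 / \<gamma> - 1) * u powr \<gamma> + M powr (1 / \<gamma>))"
          using M \<gamma>1 u by (intro mult_left_mono powr_young) auto
        also have "u powr \<gamma> = ?d y powr \<sigma> / R powr \<sigma>"
          by (simp add: u_def powr_powr \<beta>\<gamma> powr_divide)
        also have "R powr \<beta> * (M powr (1 / \<gamma> - 1) * (?d y powr \<sigma> / R powr \<sigma>) + M powr (1 / \<gamma>))
          = ?c * ?d y powr \<sigma> + ?b"
          by (simp add: powr_diff algebra_simps)
        finally show ?thesis .
      qed
      have int: "integrable lborel (\<lambda>y. indicator ?S y *\<^sub>R ?d y powr \<sigma>)"
        using set_integrable_infdist_powr[of "ball x (2 * R)" \<rho> E \<sigma>] \<rho> by (simp add: set_integrable_def)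
      have fin: "emeasure lborel (ball x (2 * R)) < \<infinity>" by (rule emeasure_lborel_ball_finite)
      have intb: "integrable lborel (\<lambda>y. ?b * indicator (ball x (2 * R)) y)"
        using fin by (intro integrable_mult_right integrable_real_indicator) simp_all
      have "(LINT y:?A|lborel. ?d y powr \<beta>) \<le>
        (LINT y|lborel. ?c * (indicator ?S y *\<^sub>R ?d y powr \<sigma>) + ?b * indicator (ball x (2 * R)) y)"
        unfolding set_lebesgue_integral_def
      proof (rule integral_mono')
        show "integrable lborel (\<lambda>y. ?c * (indicator ?S y *\<^sub>R ?d y powr \<sigma>) + ?b * indicator (ball x (2 * R)) y)"
          by (intro Bochner_Integration.integrable_add integrable_mult_right int intb)
        fix y
        show nonneg: "0 \<le> ?c * (indicator ?S y *\<^sub>R ?d y powr \<sigma>) + ?b * indicator (ball x (2 * R)) y"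
          by (intro add_nonneg_nonneg mult_nonneg_nonneg) auto
        show "indicator ?A y *\<^sub>R ?d y powr \<beta> \<le> ?c * (indicator ?S y *\<^sub>R ?d y powr \<sigma>) + ?b * indicator (ball x (2 * R)) y"
        proof (cases "y \<in> ?A")
          case True
          then show ?thesis using young[of y] by simp
        next
          case False
          then show ?thesis using nonneg by simp
        qed
      qed
      also have "\<dots> = ?c * (LINT y:?S|lborel. ?d y powr \<sigma>) + ?b * measure lborel (ball x (2 * R))"
        using int intb by (subst Bochner_Integration.integral_add) (auto simp: set_lebesgue_integral_def)
      also have "\<dots> \<le> ?c * (M * (2 * R) powr (n + \<sigma>)) + ?b * measure lborel (ball x (2 * R))"
        using Q x \<rho> unfolding Q_def by (intro add_right_mono mult_left_mono) auto
      also have "\<dots> = M powr (1 / \<gamma>) * C2 * R powr (n + \<beta>)"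
      proof -
        have 1: "M powr (1 / \<gamma> - 1) * M = M powr (1 / \<gamma>)" using M by (simp add: powr_diff)
        have 2: "R powr (\<beta> - \<sigma>) * R powr (n + \<sigma>) = R powr (n + \<beta>)" using R by (simp add: add.commute flip: powr_add)
        have "?c * (M * (2 * R) powr (n + \<sigma>)) = (M powr (1 / \<gamma> - 1) * M) * 2 powr (n + \<sigma>) * (R powr (\<beta> - \<sigma>) * R powr (n + \<sigma>))"
          by (simp only: powr_mult mult_ac)
        also have "\<dots> = M powr (1 / \<gamma>) * 2 powr (n + \<sigma>) * R powr (n + \<beta>)" unfolding 1 2 ..
        finally have 3: "?c * (M * (2 * R) powr (n + \<sigma>)) = M powr (1 / \<gamma>) * 2 powr (n + \<sigma>) * R powr (n + \<beta>)" .
        have 4: "?b * measure lborel (ball x (2 * R)) = M powr (1 / \<gamma>) * (\<omega> * 2 powr n) * R powr (n + \<beta>)"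
          unfolding vol[OF R] by (simp add: powr_add mult_ac)
        show ?thesis unfolding 3 4 C2_def by (simp add: algebra_simps)
      qed
      finally show "(LINT y:?A|lborel. ?d y powr \<beta>) \<le> M powr (1 / \<gamma>) * C2 * R powr (n + \<beta>)" .
    qed
    also have "\<dots> \<le> M * R powr (n + \<sigma>)"
    proof (rule mult_right_mono)
      have "1 \<le> M powr (1 / \<gamma>)" using M \<gamma>1 by (intro ge_one_powr_ge_zero) auto
      then have "(M powr (1 / \<gamma>) * C2 + 1) powr (q / p) \<le> (M powr (1 / \<gamma>) * (C2 + 1)) powr (q / p)"
        using pos qp by (intro powr_mono2) (auto simp: distrib_left)
      also have "\<dots> = M powr \<theta> * (C2 + 1) powr (q / p)"
        unfolding powr_mult powr_powr by (simp add: \<theta>_def mult.commute)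
      finally have "C * (M powr (1 / \<gamma>) * C2 + 1) powr (q / p) \<le> C3 * M powr \<theta>"
        using C(1) by (simp add: C3_def mult_ac)
      then show "C * (M powr (1 / \<gamma>) * C2 + 1) powr (q / p) \<le> M" using C3M by linarith
    qed simp
    finally show "(LINT y:{y \<in> ball x R. \<eta> \<le> ?d y}|lborel. ?d y powr \<sigma>) \<le> M * R powr (n + \<sigma>)" .
  qed
  have iter: "0 < R \<Longrightarrow> 2 * diameter E + 1 \<le> 2 ^ j * R \<Longrightarrow> Q R" for j R
  proof (induction j arbitrary: R)
    case 0
    then show ?case by (simp add: large)
  next
    case (Suc j)
    then have "Q (2 * R)" by (intro Suc.IH) (auto simp: mult_ac)
    then show ?case using Suc.prems(1) step by blast
  qed
  have "Q R" if R: "0 < R" for R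
  proof -
    obtain j where "(2 * diameter E + 1) / R < 2 ^ j" using real_arch_pow[of 2 "(2 * diameter E + 1) / R"] by auto
    then show ?thesis using iter[OF R, of j] R by (simp add: pos_divide_less_eq)
  qed
  then show ?thesis
    using M(1) unfolding Q_def by (intro exI[of _ M]) simp
qed

lemma assouad_dim_less_if_distance_integral_bound:
  fixes E :: "'a::euclidean_space set" and \<sigma> :: real
  assumes E: "closed E" "E \<in> null_sets lborel" and s: "0 < DIM('a) + \<sigma>" "\<sigma> < 0"
    and int: "\<exists>C\<ge>0. \<forall>x\<in>E. \<forall>R>0. \<forall>\<eta>>0.
      (LINT y:{y \<in> ball x R. \<eta> \<le> infdist y E}|lborel. infdist y E powr \<sigma>) \<le> C * R powr (DIM('a) + \<sigma>)"
  shows "assouad_dim E < ereal (DIM('a) + \<sigma>)"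
proof -
  from int obtain C where C: "0 \<le> C" "\<forall>x\<in>E. \<forall>R>0. \<forall>\<eta>>0.
      (LINT y:{y \<in> ball x R. \<eta> \<le> infdist y E}|lborel. infdist y E powr \<sigma>) \<le> C * R powr (DIM('a) + \<sigma>)"
    by (elim exE conjE) (rule that)
  show ?thesis
    using C s by (intro assouad_dim_less[OF E _ _ C(1)]) auto
qed

theorem theorem4p6:
  fixes G :: "(real ^ 'n::finite) set" and p q \<beta> n :: real
  defines "n \<equiv> real CARD('n)"
  assumes "2 \<le> CARD('n)"
    and "open G" and "G \<noteq> {}" and "frontier G \<noteq> {}"
    and "1 \<le> p" and "p \<le> q" and "p < n" and "q < n * p / (n - p)"
    and "hardy_sobolev q p \<beta> G"
  shows "(0 \<le> \<beta> \<and> q * (n - p + \<beta>) / p \<noteq> n \<longrightarrow>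
            assouad_dim (- G) < ereal (q / p * (n - p + \<beta>)) \<or>
            hausdorff_dim (- G) \<ge> ereal (n - p + \<beta>))
       \<and> (\<beta> < 0 \<and> compact (- G) \<and> porous (- G) \<longrightarrow>
            assouad_dim (- G) < ereal (q / p * (n - p + \<beta>)) \<or>
            lower_minkowski_dim (- G) \<ge> ereal (n - p + \<beta>))"
proof -
  define E where "E = - G"
  define \<tau> where "\<tau> = n - p + \<beta>"
  define \<sigma> where "\<sigma> = q / p * \<tau> - n"
  have G: "G = - E" by (simp add: E_def)
  have "G \<noteq> UNIV" using assms(5) by (metis frontier_UNIV)
  then have E: "closed E" "E \<noteq> {}"
    using assms(3) by (auto simp: E_def)
  have p: "1 \<le> p" "p \<le> q" "p < n" "q < n * p / (n - p)" and hs: "hardy_sobolev q p \<beta> (- E)"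
    using assms by (simp_all add: G)
  have qp: "1 \<le> q / p" using p by simp
  have n: "n + \<sigma> = q / p * \<tau>" "DIM(real ^ 'n) = n" by (simp_all add: \<sigma>_def n_def)
  have null: "E \<in> null_sets lborel" "frontier E = E"
    if "fine_covers K \<tau> \<beta> E" "\<sigma> < 0" "0 < \<tau>" for K
  proof -
    have "\<tau> \<le> q / p * \<tau>" using mult_right_mono[OF qp, of \<tau>] that(3) by linarith
    then have "\<tau> \<le> n" using that(2) by (simp add: \<sigma>_def)
    then show "E \<in> null_sets lborel" using fine_covers_imp_null[OF E(1) that(1)] n by simp
    then show "frontier E = E" by (rule frontier_null_closed[OF E(1)])
  qed
  have concl: "assouad_dim E < ereal (q / p * \<tau>)"
    if "E \<in> null_sets lborel" "\<sigma> < 0" "0 < \<tau>"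
      "\<exists>C\<ge>0. \<forall>x\<in>E. \<forall>R>0. \<forall>\<eta>>0.
        (LINT y:{y \<in> ball x R. \<eta> \<le> infdist y E}|lborel. infdist y E powr \<sigma>) \<le> C * R powr (n + \<sigma>)"
  proof -
    have "0 < n + \<sigma>" unfolding n(1) using qp that(3) by (intro mult_pos_pos) linarith+
    then show ?thesis
      using assouad_dim_less_if_distance_integral_bound[OF E(1) that(1), of \<sigma>] that(2,4) n by simp
  qed
  have "assouad_dim E < ereal (q / p * \<tau>)"
    if \<beta>: "0 \<le> \<beta>" and ne: "q * \<tau> / p \<noteq> n" and dim: "hausdorff_dim E < ereal \<tau>"
  proof -
    have "0 \<le> hausdorff_dim E" unfolding hausdorff_dim_def by (rule Inf_greatest) auto
    then have \<tau>: "0 < \<tau>" using dim by (metis ereal_less(2) le_less_trans)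
    show ?thesis
    proof (cases "n < q / p * \<tau>")
      case True
      have "assouad_dim E \<le> ereal n" using assouad_dim_le_DIM[of E] n by simp
      also have "\<dots> < ereal (q / p * \<tau>)" using True by simp
      finally show ?thesis .
    next
      case False
      then have \<sigma>: "\<sigma> < 0" using ne by (simp add: \<sigma>_def)
      have cov: "fine_covers (2 powr \<beta>) \<tau> \<beta> E" by (rule fine_covers_hausdorff[OF E(1) dim \<beta>])
      have "\<exists>C\<ge>0. \<forall>x\<in>E. \<forall>R>0. \<forall>\<eta>>0.
          (LINT y:{y \<in> ball x R. \<eta> \<le> infdist y E}|lborel. infdist y E powr \<sigma>) \<le> C * R powr (n + \<sigma>)"
        using distance_integral_bound_nonneg[OF hs E null(2)[OF cov \<sigma> \<tau>] p(1,2) _ cov[unfolded \<tau>_def n_def] \<beta>]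
        by (simp add: \<sigma>_def \<tau>_def n_def)
      then show ?thesis by (rule concl[OF null(1)[OF cov \<sigma> \<tau>] \<sigma> \<tau>])
    qed
  qed
  moreover have "assouad_dim E < ereal (q / p * \<tau>)"
    if \<beta>: "\<beta> < 0" and comp: "compact E" and dim: "lower_minkowski_dim E < ereal \<tau>"
  proof -
    have "0 \<le> lower_minkowski_dim E" unfolding lower_minkowski_dim_def by (rule Inf_greatest) auto
    then have \<tau>: "0 < \<tau>" using dim by (metis ereal_less(2) le_less_trans)
    have "q / p * (n - p) < n" using p by (simp add: field_simps)
    moreover have "q / p * \<beta> < 0" using qp \<beta> by (intro mult_pos_neg) auto
    moreover have "\<sigma> = q / p * (n - p) + q / p * \<beta> - n" by (simp only: \<sigma>_def \<tau>_def distrib_left)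
    ultimately have \<sigma>: "\<sigma> < 0" by linarith
    have cov: "fine_covers (2 powr - \<beta>) \<tau> \<beta> E"
      using fine_covers_minkowski[OF comp dim] \<beta> by simp
    have "\<exists>C\<ge>0. \<forall>x\<in>E. \<forall>R>0. \<forall>\<eta>>0.
        (LINT y:{y \<in> ball x R. \<eta> \<le> infdist y E}|lborel. infdist y E powr \<sigma>) \<le> C * R powr (n + \<sigma>)"
      using distance_integral_bound_neg[OF hs comp E(2) null(2)[OF cov \<sigma> \<tau>] p(1,2) p(3,4)[unfolded n_def]
          _ cov[unfolded \<tau>_def n_def] \<beta>]
      by (simp add: \<sigma>_def \<tau>_def n_def)
    then show ?thesis by (rule concl[OF null(1)[OF cov \<sigma> \<tau>] \<sigma> \<tau>])
  qed
  ultimately show ?thesis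
    unfolding E_def[symmetric] \<tau>_def[symmetric] by (meson not_le)
qed

end
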